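(* Let $n=2m$ be an even positive integer, let $K_n:=\bigl|\{1\leq k\leq n : S_k=0\}\bigr|$ be the number of returns to the origin up to time $n$ of the simple symmetric random walk $(S_k)_{k\ge 0}$, and let $W:=K_n/\sqrt{n}$. Let $Y:=|Z|$, where $Z$ is a standard normal random variable. Then $$d_{\mathcal{W}}(W,Y)\leq\frac{1}{\sqrt{n}}\left(\frac{2}{\pi}+2\right)+\frac{1}{n}\sqrt{\frac{2}{\pi}}$$ and $$d_{\mathcal{K}}(W,Y)\leq\frac{1}{\sqrt{n}}\left(\frac{3+2\sqrt{2}}{\sqrt{2\pi}}+\frac{3}{4}\right)+\frac{3}{2n}.$$
   Context: The simple symmetric random walk is $S_0:=0$, $S_k:=\sum_{j=1}^k X_j$ for $k\geq 1$, where $X_1,X_2,\dots$ are i.i.d. with $P(X_1=1)=P(X_1=-1)=1/2$. For real random variables $U,V$ with finite first moments, the Wasserstein distance is $d_{\mathcal{W}}(U,V):=\sup_{h}|E[h(U)]-E[h(V)]|$, where the supremum is over all functions $h:\mathbb{R}\to\mathbb{R}$ that are Lipschitz continuous with Lipschitz constant at most $1$. The Kolmogorov distance is $d_{\mathcal{K}}(U,V):=\sup_{z\in\mathbb{R}}|P(U\leq z)-P(V\leq z)|$. Both depend only on the distributions of $U$ and $V$. *)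

theory Defs
  imports "HOL-Probability.Probability"
begin

text \<open>
  Both distances compare random variables that may live on different probability spaces.
  The Wasserstein distance is used for integrable \<open>U\<close> and \<open>V\<close>; all expectations in it then exist.
  Its supremum is taken in \<^typ>\<open>ereal\<close>, so that it is meaningful without a proof of boundedness.
  The supremum in the Kolmogorov distance is bounded by 1.
\<close>

definition wasserstein_dist ::
    "'a measure \<Rightarrow> ('a \<Rightarrow> real) \<Rightarrow> 'b measure \<Rightarrow> ('b \<Rightarrow> real) \<Rightarrow> ereal" where
  "wasserstein_dist M U N V =
     (SUP h \<in> {h :: real \<Rightarrow> real. 1-lipschitz_on UNIV h}.
        ereal \<bar>(\<integral>x. h (U x) \<partial>M) - (\<integral>y. h (V y) \<partial>N)\<bar>)"

definition kolmogorov_dist ::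
    "'a measure \<Rightarrow> ('a \<Rightarrow> real) \<Rightarrow> 'b measure \<Rightarrow> ('b \<Rightarrow> real) \<Rightarrow> real" where
  "kolmogorov_dist M U N V =
     (SUP z :: real. \<bar>measure M {x \<in> space M. U x \<le> z} - measure N {y \<in> space N. V y \<le> z}\<bar>)"

definition walk :: "(nat \<Rightarrow> 'a \<Rightarrow> real) \<Rightarrow> nat \<Rightarrow> 'a \<Rightarrow> real" where
  "walk X k \<omega> = (\<Sum>j = 1..k. X j \<omega>)"

definition returns :: "(nat \<Rightarrow> 'a \<Rightarrow> real) \<Rightarrow> nat \<Rightarrow> 'a \<Rightarrow> nat" where
  "returns X n \<omega> = card {k. 1 \<le> k \<and> k \<le> n \<and> walk X k \<omega> = 0}"

text \<open>
  Independent steps indexed from 1. That they are identically distributed is part of the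
  second conjunct, since the two probabilities determine the law of each step.
\<close>

definition simple_symmetric_steps :: "'a measure \<Rightarrow> (nat \<Rightarrow> 'a \<Rightarrow> real) \<Rightarrow> bool" where
  "simple_symmetric_steps M X \<longleftrightarrow>
     prob_space.indep_vars M (\<lambda>_. borel) X {1..} \<and>
     (\<forall>j\<ge>1. measure M {\<omega> \<in> space M. X j \<omega> = 1} = 1 / 2 \<and>
            measure M {\<omega> \<in> space M. X j \<omega> = -1} = 1 / 2)"

end

theory Submission
  imports Defs "HOL-Real_Asymp.Real_Asymp"
begin

text \<open>
  Let \<open>K\<close> be the number of returns up to time \<open>n = 2 m\<close>, let \<open>V = sqrt n \<bar>Z\<bar>\<close> and let
  \<open>C = \<lceil>V\<rceil>\<close>. Scaling by \<open>sqrt n\<close> turns the two claims into bounds on the distance between \<open>K\<close>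
  and \<open>V\<close>, and these are proved by a stochastic comparison of the integer variables \<open>K\<close> and \<open>C\<close>.

  The law of \<open>K\<close> is explicit: \<open>P(K = r) = p r = (2 m - r choose m) / 2 ^ (2 m - r)\<close>. Its ratios satisfy
  \<open>p (r + 1) / p r \<le> 1 - r / n \<le> exp (- r / n)\<close>. The masses \<open>P(C = r)\<close>, which are the integrals of
  the density \<open>f\<close> of \<open>V\<close> over \<open>(r - 1, r]\<close>, satisfy the reverse inequality
  \<open>P(C = r + 1) / P(C = r) \<ge> exp (- r / n)\<close>, by convexity of \<open>exp\<close> and because \<open>f\<close> decreases. So
  \<open>P(C = r)\<close> crosses \<open>p r\<close> once, from below, and therefore \<open>E g(K) \<le> E g(C)\<close> for every
  nondecreasing \<open>g\<close> (lemma \<open>returns_dominated\<close>).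

  For a 1-Lipschitz \<open>h\<close> both \<open>x + h x\<close> and \<open>x - h x\<close> are nondecreasing, whence
  \<open>\<bar>E h(K) - E h(C)\<bar> \<le> E C - E K\<close>. Together with \<open>\<bar>E h(C) - E h(V)\<bar> \<le> E C - E V\<close> this gives
  \<open>\<bar>E h(K) - E h(V)\<bar> \<le> 2 (E C - E V) + (E V - E K)\<close>. Here \<open>E C - E V \<le> 1 / 2 + f 0 / 2\<close>, because
  rounding up a variable with nearly constant density adds \<open>1 / 2\<close> on average, and
  \<open>E V - E K \<le> 1\<close>, because \<open>E K = (n + 1) p 0 - 1\<close> exactly and Wallis' product bounds \<open>p 0\<close> from
  below. The total is \<open>2 + f 0\<close> with \<open>f 0 = sqrt (2 / (pi n))\<close>.

  For the Kolmogorov distance, the comparison of \<open>K\<close> with \<open>C\<close> shows that the distribution function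
  of \<open>V\<close> exceeds that of \<open>K\<close> by at most the \<open>V\<close>-mass of one unit interval, hence by at most \<open>f 0\<close>.
  In the other direction \<open>p (r + 1) \<le> f r \<le> P(C = r)\<close> lets all but the first two masses of \<open>K\<close> be
  absorbed by those of \<open>C\<close>, which leaves an excess of at most \<open>2 f 0\<close>.
\<close>

section \<open>Counting sign sequences by their number of returns\<close>

text \<open>
  The recursion of the probability that the walk started at 0 reaches level \<open>a\<close> within \<open>j\<close> steps.
  The time of the \<open>r\<close>-th return to 0 is distributed as \<open>r\<close> plus the first time at level \<open>r\<close>: from 0 the
  walk is forced to distance 1, and by symmetry each way back is as long as the ascent of one level.
\<close>

fun hit_prob :: "nat \<Rightarrow> nat \<Rightarrow> real" where
  "hit_prob 0 a = of_bool (a = 0)"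
| "hit_prob (Suc j) 0 = 1"
| "hit_prob (Suc j) (Suc a) = (hit_prob j (Suc (Suc a)) + hit_prob j a) / 2"

lemma hit_prob_zero [simp]: "hit_prob j 0 = 1"
  by (cases j) auto

text \<open>
  The left-hand side satisfies the same two-term recursion as Pascal's triangle, also at the
  boundary \<open>a = 0\<close>, where the binomial coefficients of odd order are symmetric.
\<close>

lemma hit_prob_diff:
  "Suc j + a = 2 * q \<Longrightarrow> hit_prob (Suc j) a - hit_prob j (Suc a) = real (Suc j choose q) / 2 ^ Suc j"
proof (induction j arbitrary: a q)
  case 0
  show ?case
  proof (cases "a = 1")
    case True
    then have "q = 1" using 0 by simp
    then show ?thesis using True by simp
  next
    case False
    then have "a \<ge> 3" using 0 by presburger
    then have b: "a = Suc (Suc (Suc (a - 3)))" by simp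
    have "q \<ge> 2" using 0 \<open>a \<ge> 3\<close> by simp
    then show ?thesis by (subst (1 2) b) (simp add: binomial_eq_0)
  qed
next
  case (Suc j)
  show ?case
  proof (cases a)
    case 0
    with Suc.prems obtain q' where q: "q = Suc q'" "Suc (Suc j) = 2 * Suc q'"
      by (cases q) auto
    then have j: "j = 2 * q'" by simp
    have 1: "hit_prob (Suc j) 1 - hit_prob j (Suc 1) = real (Suc j choose q) / 2 ^ Suc j"
      by (rule Suc.IH) (use q in simp)
    have "Suc j choose q' = Suc j choose q"
      using binomial_symmetric[of q' "Suc j"] j q by simp
    moreover have "Suc (Suc j) choose q = (Suc j choose q') + (Suc j choose q)"
      unfolding q(1) by (rule binomial_Suc_Suc)
    ultimately have "real (Suc (Suc j) choose q) = 2 * real (Suc j choose q)"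
      by simp
    moreover have "hit_prob (Suc (Suc j)) 0 - hit_prob (Suc j) (Suc 0) = hit_prob (Suc j) 1 - hit_prob j (Suc 1)"
      by (simp add: field_simps)
    ultimately show ?thesis
      unfolding 0 1 by simp
  next
    case (Suc c)
    with Suc.prems obtain q' where q: "q = Suc q'" by (cases q) auto
    have 1: "hit_prob (Suc j) (Suc (Suc c)) - hit_prob j (Suc (Suc (Suc c))) = real (Suc j choose q) / 2 ^ Suc j"
      by (rule Suc.IH) (use Suc Suc.prems q in simp)
    have 2: "hit_prob (Suc j) c - hit_prob j (Suc c) = real (Suc j choose q') / 2 ^ Suc j"
      by (rule Suc.IH) (use Suc Suc.prems q in simp)
    have "hit_prob (Suc (Suc j)) (Suc c) - hit_prob (Suc j) (Suc (Suc c)) =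
      ((hit_prob (Suc j) (Suc (Suc c)) - hit_prob j (Suc (Suc (Suc c)))) + (hit_prob (Suc j) c - hit_prob j (Suc c))) / 2"
      by (simp add: field_simps)
    also have "\<dots> = real (Suc (Suc j) choose q) / 2 ^ Suc (Suc j)"
      unfolding 1 2 q binomial_Suc_Suc by (simp add: field_simps)
    finally show ?thesis using Suc by simp
  qed
qed

fun zeros :: "int \<Rightarrow> int list \<Rightarrow> nat" where
  "zeros d [] = 0"
| "zeros d (x # xs) = of_bool (d + x = 0) + zeros (d + x) xs"

definition sign_lists :: "nat \<Rightarrow> int list set" where
  "sign_lists k = {xs. set xs \<subseteq> {-1, 1} \<and> length xs = k}"

lemma finite_sign_lists [simp]: "finite (sign_lists k)"
  unfolding sign_lists_def by (rule finite_lists_length_eq) simp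

lemma card_sign_lists: "card (sign_lists k) = 2 ^ k"
  unfolding sign_lists_def by (subst card_lists_length_eq) (auto simp: numeral_2_eq_2)

lemma sign_lists_Suc: "sign_lists (Suc k) = (#) 1 ` sign_lists k \<union> (#) (-1) ` sign_lists k"
  by (auto simp: sign_lists_def length_Suc_conv image_iff)

lemma zeros_uminus: "zeros (-d) (map uminus xs) = zeros d xs"
proof (induction xs arbitrary: d)
  case (Cons x xs)
  have "- d - x = 0 \<longleftrightarrow> d + x = 0" by auto
  with Cons[of "d + x"] show ?case by simp
qed simp

definition ge_count :: "nat \<Rightarrow> int \<Rightarrow> nat \<Rightarrow> nat" where
  "ge_count k d r = card {xs \<in> sign_lists k. zeros d xs \<ge> r}"

lemma ge_count_0: "ge_count k d 0 = 2 ^ k"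
  by (simp add: ge_count_def card_sign_lists)

lemma ge_count_uminus: "ge_count k (-d) r = ge_count k d r"
proof -
  have inv: "map uminus (map uminus xs) = xs" for xs :: "int list"
    by (simp add: o_def)
  have mem: "map uminus xs \<in> sign_lists k" if "xs \<in> sign_lists k" for xs
    using that by (auto simp: sign_lists_def)
  have z: "zeros d (map uminus xs) = zeros (-d) xs" for xs
    using zeros_uminus[of "-d" xs] by simp
  have "bij_betw (map uminus) {xs \<in> sign_lists k. zeros (-d) xs \<ge> r} {xs \<in> sign_lists k. zeros d xs \<ge> r}"
    by (rule bij_betw_byWitness[where f'="map uminus"])
       (use inv mem z zeros_uminus in \<open>auto simp del: map_map\<close>)
  then show ?thesis unfolding ge_count_def by (rule bij_betw_same_card)
qed

lemma ge_count_Suc: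
  "ge_count (Suc k) d r =
     ge_count k (d + 1) (r - of_bool (d + 1 = 0)) + ge_count k (d - 1) (r - of_bool (d - 1 = 0))"
proof -
  define A where "A = {xs \<in> sign_lists k. zeros (d + 1) xs \<ge> r - of_bool (d + 1 = 0)}"
  define B where "B = {xs \<in> sign_lists k. zeros (d - 1) xs \<ge> r - of_bool (d - 1 = 0)}"
  have 1: "xs \<in> A \<longleftrightarrow> xs \<in> sign_lists k \<and> zeros d (1 # xs) \<ge> r" for xs
    unfolding A_def by auto
  have 2: "xs \<in> B \<longleftrightarrow> xs \<in> sign_lists k \<and> zeros d ((-1) # xs) \<ge> r" for xs
    unfolding B_def by auto
  have "{xs \<in> sign_lists (Suc k). zeros d xs \<ge> r} = (#) 1 ` A \<union> (#) (-1) ` B"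
    unfolding sign_lists_Suc using 1 2 by blast
  moreover have "card ((#) 1 ` A \<union> (#) (-1) ` B) = card A + card B"
  proof (subst card_Un_disjoint)
    show "finite ((#) 1 ` A)" "finite ((#) (-1) ` B)" unfolding A_def B_def by auto
    show "(#) 1 ` A \<inter> (#) (-1) ` B = {}" by auto
    show "card ((#) 1 ` A) + card ((#) (-1) ` B) = card A + card B" by (simp add: card_image)
  qed
  ultimately show ?thesis unfolding ge_count_def A_def B_def by simp
qed

text \<open>
  From the origin, \<open>r\<close> visits within \<open>k\<close> steps are as likely as climbing \<open>r\<close> levels in \<open>k - r\<close>
  steps; from distance \<open>a > 0\<close> the first visit needs no forced step, which explains \<open>Suc k - r\<close> and
  \<open>a + r - 1\<close>. Both formulas obey the first-step recursion. If \<open>r\<close> exceeds the number of steps,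
  truncated subtraction gives the time 0, at which a positive level is reached with probability 0.
\<close>

lemma ge_count_hit:
  "ge_count k 0 r = 2 ^ k * hit_prob (k - r) r"
  "r > 0 \<Longrightarrow> a > 0 \<Longrightarrow> ge_count k (int a) r = 2 ^ k * hit_prob (Suc k - r) (a + r - 1)"
proof (induction k arbitrary: a r)
  case 0
  {
    case 1
    have "{xs \<in> sign_lists 0. zeros 0 xs \<ge> r} = (if r = 0 then {[]} else {})"
      by (auto simp: sign_lists_def)
    then show ?case by (simp add: ge_count_def)
  next
    case 2
    then show ?case by (auto simp: ge_count_def sign_lists_def)
  }
next
  case (Suc k)
  {
    case 1
    show ?case
    proof (cases "r = 0")
      case False
      have "ge_count (Suc k) 0 r = 2 * ge_count k 1 r"
        unfolding ge_count_Suc using ge_count_uminus[of k 1 r] by simp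
      then show ?thesis using Suc.IH(2)[of r 1] False by simp
    qed (simp add: ge_count_0)
  next
    case (2 a r)
    \<comment> \<open>At \<open>a = 1\<close> the downward step is itself a visit, so the formula for the origin applies to \<open>r - 1\<close>.\<close>
    have *: "real (ge_count (Suc k) (int a) r) = 2 ^ k * hit_prob (Suc k - r) (a + r) 
       + 2 ^ k * hit_prob (Suc k - r) (a + r - 2)"
    proof (cases "a = 1")
      case True
      then show ?thesis unfolding ge_count_Suc using 2 Suc.IH(2)[of r 2] Suc.IH(1)[of "r - 1"]
        by (simp add: numeral_2_eq_2)
    next
      case False
      have "int a - 1 = int (a - 1)" "int a + 1 = int (Suc a)" using 2 by auto
      then show ?thesis unfolding ge_count_Suc using 2 False Suc.IH(2)[of r "Suc a"] Suc.IH(2)[of r "a-1"]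
        by (simp add: numeral_2_eq_2 add.commute)
    qed
    show ?case
    proof (cases "r \<le> Suc k")
      case True
      obtain c where c: "a + r - 1 = Suc c" using 2 by (metis One_nat_def Suc_pred add_gr_0 add_Suc_right diff_Suc_1)
      have "a + r = Suc (Suc c)" "a + r - 2 = c" using c by auto
      then show ?thesis unfolding * c using True by (simp add: Suc_diff_le field_simps)
    next
      case False
      then show ?thesis unfolding * using 2 by auto
    qed
  }
qed

definition ret_prob :: "nat \<Rightarrow> nat \<Rightarrow> real" where
  "ret_prob m r = real ((2 * m - r) choose m) / 2 ^ (2 * m - r)"

text \<open>
  Exactly \<open>r\<close> returns are at least \<open>r\<close> but not at least \<open>r + 1\<close> of them. The two hitting probabilities
  belong to adjacent times and levels, so their difference is a single binomial probability.
\<close>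

lemma hit_prob_ret_prob:
  assumes "m > 0" 
  shows "hit_prob (2*m - r) r - hit_prob (2*m - Suc r) (Suc r) = ret_prob m r"
proof (cases "r < 2 * m")
  case True
  define j where "j = 2*m - Suc r"
  have j: "2*m - r = Suc j" using True by (simp add: j_def)
  show ?thesis using hit_prob_diff[of j r m] True unfolding ret_prob_def j j_def[symmetric] by (simp add: j_def)
next
  case False
  then show ?thesis using assms by (simp add: ret_prob_def)
qed

lemma card_zeros:
  assumes "m > 0"
  shows "card {xs \<in> sign_lists (2*m). zeros 0 xs = r} = 2 ^ (2*m) * ret_prob m r"
proof -
  have "{xs \<in> sign_lists (2*m). zeros 0 xs = r} =
     {xs \<in> sign_lists (2*m). zeros 0 xs \<ge> r} - {xs \<in> sign_lists (2*m). zeros 0 xs \<ge> Suc r}"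
    by auto
  moreover have "{xs \<in> sign_lists (2*m). zeros 0 xs \<ge> Suc r} \<subseteq> {xs \<in> sign_lists (2*m). zeros 0 xs \<ge> r}"
    by auto
  ultimately have "card {xs \<in> sign_lists (2*m). zeros 0 xs = r} = 
     real (ge_count (2*m) 0 r) - real (ge_count (2*m) 0 (Suc r))"
    unfolding ge_count_def
    by (simp add: card_Diff_subset of_nat_diff card_mono)
  then show ?thesis
    unfolding ge_count_hit hit_prob_ret_prob[OF assms, symmetric] by (simp add: algebra_simps)
qed

lemma zeros_le_length: "zeros d xs \<le> length xs"
  by (induction xs arbitrary: d) (auto intro: le_SucI)

lemma sum_sign_lists_zeros:
  fixes F :: "nat \<Rightarrow> real"
  assumes "m > 0"
  shows "(\<Sum>xs\<in>sign_lists (2*m). F (zeros 0 xs)) = 2 ^ (2*m) * (\<Sum>r\<le>2*m. ret_prob m r * F r)"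
proof -
  have im: "zeros 0 ` sign_lists (2*m) \<subseteq> {..2*m}"
  proof
    fix r assume "r \<in> zeros 0 ` sign_lists (2*m)"
    then obtain xs where "xs \<in> sign_lists (2*m)" "r = zeros 0 xs" by blast
    then show "r \<in> {..2*m}" using zeros_le_length[of 0 xs] by (simp add: sign_lists_def)
  qed
  have "(\<Sum>xs\<in>sign_lists (2*m). F (zeros 0 xs)) =
     (\<Sum>r\<le>2*m. \<Sum>xs\<in>{xs \<in> sign_lists (2*m). zeros 0 xs = r}. F (zeros 0 xs))"
    by (rule sum.group[OF finite_sign_lists finite_atMost im, symmetric])
  also have "\<dots> = (\<Sum>r\<le>2*m. 2 ^ (2*m) * (ret_prob m r * F r))"
  proof (rule sum.cong[OF refl])
    fix r
    have "(\<Sum>xs\<in>{xs \<in> sign_lists (2*m). zeros 0 xs = r}. F (zeros 0 xs)) =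
      (\<Sum>xs\<in>{xs \<in> sign_lists (2*m). zeros 0 xs = r}. F r)"
      by (rule sum.cong) auto
    also have "\<dots> = 2 ^ (2*m) * ret_prob m r * F r"
      unfolding sum_constant card_zeros[OF assms, of r] by simp
    finally show "(\<Sum>xs\<in>{xs \<in> sign_lists (2*m). zeros 0 xs = r}. F (zeros 0 xs)) =
      2 ^ (2*m) * (ret_prob m r * F r)" by simp
  qed
  finally show ?thesis by (simp add: sum_distrib_left)
qed

lemma sum_ret_prob: "m > 0 \<Longrightarrow> (\<Sum>r\<le>2*m. ret_prob m r) = 1"
  using sum_sign_lists_zeros[of m "\<lambda>_. 1"] by (simp add: card_sign_lists)

section \<open>The law of the number of returns\<close>

lemma walk_Suc: "walk X (Suc k) \<omega> = walk X k \<omega> + X (Suc k) \<omega>"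
  by (simp add: walk_def)

lemma card_walk_zeros:
  assumes "\<And>i. i < length xs \<Longrightarrow> X (Suc (k + i)) \<omega> = real_of_int (xs ! i)"
    and "walk X k \<omega> = real_of_int d"
  shows "card {j. k < j \<and> j \<le> k + length xs \<and> walk X j \<omega> = 0} = zeros d xs"
  using assms
proof (induction xs arbitrary: k d)
  case Nil
  have "{j. k < j \<and> j \<le> k + length [] \<and> walk X j \<omega> = 0} = {}" by auto
  then show ?case by simp
next
  case (Cons x xs)
  have step: "X (Suc k) \<omega> = real_of_int x" using Cons.prems(1)[of 0] by simp
  have w: "walk X (Suc k) \<omega> = real_of_int (d + x)"
    unfolding walk_Suc using step Cons.prems(2) by simp
  have IH: "card {j. Suc k < j \<and> j \<le> Suc k + length xs \<and> walk X j \<omega> = 0} = zeros (d + x) xs"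
    (is "card ?A = _")
  proof (rule Cons.IH[OF _ w])
    fix i assume "i < length xs"
    then show "X (Suc (Suc k + i)) \<omega> = real_of_int (xs ! i)"
      using Cons.prems(1)[of "Suc i"] by simp
  qed
  let ?B = "{j. k < j \<and> j \<le> k + length (x # xs) \<and> walk X j \<omega> = 0}"
  have "walk X (Suc k) \<omega> = 0 \<longleftrightarrow> d + x = 0" unfolding w by (rule of_int_eq_0_iff)
  then have "j \<in> ?B \<longleftrightarrow> (j = Suc k \<and> d + x = 0) \<or> j \<in> ?A" for j
  proof (cases "j = Suc k")
    case True
    then show ?thesis using \<open>walk X (Suc k) \<omega> = 0 \<longleftrightarrow> d + x = 0\<close> by simp
  next
    case False
    then have "k < j \<and> j \<le> k + length (x # xs) \<longleftrightarrow> Suc k < j \<and> j \<le> Suc k + length xs"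
      by auto
    with False show ?thesis by blast
  qed
  then have "?B = (if d + x = 0 then {Suc k} else {}) \<union> ?A"
    by (intro set_eqI) (simp only: Un_iff split: if_split, blast)
  moreover have "card ((if d + x = 0 then {Suc k} else {}) \<union> ?A) = of_bool (d + x = 0) + card ?A"
    by (subst card_Un_disjoint) auto
  ultimately show ?case using IH by (simp only: zeros.simps)
qed

lemma returns_eq_zeros:
  assumes "\<And>i. i < n \<Longrightarrow> X (Suc i) \<omega> = real_of_int (xs ! i)" "length xs = n"
  shows "returns X n \<omega> = zeros 0 xs"
  using card_walk_zeros[of xs X 0 \<omega> 0] assms unfolding returns_def
  by (simp add: walk_def Suc_le_eq)

locale simple_random_walk = prob_space M for M :: "'a measure" +
  fixes X :: "nat \<Rightarrow> 'a \<Rightarrow> real"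
  assumes X: "simple_symmetric_steps M X"
begin

lemma step_measurable: "j \<ge> 1 \<Longrightarrow> X j \<in> borel_measurable M"
  using X by (auto simp: simple_symmetric_steps_def indep_vars_def)

lemma returns_measurable: "returns X n \<in> measurable M (count_space UNIV)"
proof (induction n)
  case 0
  have "returns X 0 = (\<lambda>_. 0)" by (simp add: returns_def fun_eq_iff)
  then show ?case by simp
next
  case (Suc n)
  have w: "walk X (Suc n) \<in> borel_measurable M"
    unfolding walk_def by (intro borel_measurable_sum step_measurable) auto
  have "returns X (Suc n) \<omega> = (if walk X (Suc n) \<omega> = 0 then Suc (returns X n \<omega>) else returns X n \<omega>)" for \<omega>
  proof -
    have "{k. 1 \<le> k \<and> k \<le> Suc n \<and> walk X k \<omega> = 0} =
      (if walk X (Suc n) \<omega> = 0 then {Suc n} else {}) \<union> {k. 1 \<le> k \<and> k \<le> n \<and> walk X k \<omega> = 0}"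
      by (auto simp: le_Suc_eq)
    then show ?thesis unfolding returns_def by simp
  qed
  then have eq: "returns X (Suc n) =
      (\<lambda>\<omega>. if walk X (Suc n) \<omega> = 0 then Suc (returns X n \<omega>) else returns X n \<omega>)"
    by blast
  have "{\<omega> \<in> space M. walk X (Suc n) \<omega> = 0} \<in> sets M" using w by measurable
  then show ?case unfolding eq
    by (intro measurable_If measurable_compose[OF Suc.IH] Suc.IH) auto
qed

definition path_event :: "int list \<Rightarrow> 'a set" where
  "path_event xs = {\<omega> \<in> space M. \<forall>i < length xs. X (Suc i) \<omega> = real_of_int (xs ! i)}"

lemma path_event_sets: "path_event xs \<in> sets M"
proof -
  have [measurable]: "X (Suc i) \<in> borel_measurable M" for i by (rule step_measurable) simp
  show ?thesis unfolding path_event_def by measurable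
qed

lemma prob_path_event:
  assumes "xs \<in> sign_lists n"
  shows "prob (path_event xs) = 1 / 2 ^ n"
proof (cases "n = 0")
  case True
  then show ?thesis using assms by (simp add: path_event_def sign_lists_def prob_space)
next
  case False
  define A where "A j = {real_of_int (xs ! (j - 1))}" for j
  have len: "length xs = n" using assms by (simp add: sign_lists_def)
  have ind: "indep_vars (\<lambda>_. borel) X {1..}" using X by (simp add: simple_symmetric_steps_def)
  have "path_event xs = (\<Inter>j\<in>{1..n}. X j -` A j \<inter> space M)"
  proof (intro set_eqI iffI)
    fix \<omega> assume "\<omega> \<in> path_event xs"
    then have *: "\<omega> \<in> space M" "\<And>i. i < n \<Longrightarrow> X (Suc i) \<omega> = real_of_int (xs ! i)"
      by (auto simp: path_event_def len)
    show "\<omega> \<in> (\<Inter>j\<in>{1..n}. X j -` A j \<inter> space M)"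
    proof
      fix j assume "j \<in> {1..n}"
      then have "j - 1 < n" "Suc (j - 1) = j" by auto
      then show "\<omega> \<in> X j -` A j \<inter> space M" using *(2)[of "j - 1"] *(1) by (simp add: A_def)
    qed
  next
    fix \<omega> assume *: "\<omega> \<in> (\<Inter>j\<in>{1..n}. X j -` A j \<inter> space M)"
    then have "\<omega> \<in> space M" using False by auto
    moreover have "X (Suc i) \<omega> = real_of_int (xs ! i)" if "i < n" for i
      using * that by (force simp: A_def)
    ultimately show "\<omega> \<in> path_event xs" by (simp add: path_event_def len)
  qed
  also have "prob \<dots> = (\<Prod>j\<in>{1..n}. prob (X j -` A j \<inter> space M))"
    using False by (intro indep_varsD[OF ind]) (auto simp: A_def)
  also have "\<dots> = (\<Prod>j\<in>{1..n}. 1 / 2)"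
  proof (rule prod.cong)
    fix j assume j: "j \<in> {1..n}"
    then have "xs ! (j - 1) \<in> set xs" using len by (intro nth_mem) auto
    then have "xs ! (j - 1) = 1 \<or> xs ! (j - 1) = -1" using assms by (auto simp: sign_lists_def)
    moreover have "X j -` A j \<inter> space M = {\<omega> \<in> space M. X j \<omega> = real_of_int (xs ! (j - 1))}"
      by (auto simp: A_def)
    ultimately show "prob (X j -` A j \<inter> space M) = 1 / 2"
      using X j by (auto simp: simple_symmetric_steps_def)
  qed simp
  finally show ?thesis by (simp add: power_one_over)
qed

lemma disjoint_path_events: "disjoint_family_on path_event (sign_lists n)"
proof -
  have "xs = ys" if "\<omega> \<in> path_event xs" "\<omega> \<in> path_event ys" "xs \<in> sign_lists n" "ys \<in> sign_lists n"
    for \<omega> xs ys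
  proof (rule nth_equalityI)
    show l: "length xs = length ys" using that by (simp add: sign_lists_def)
    fix i assume i: "i < length xs"
    have "real_of_int (xs ! i) = real_of_int (ys ! i)"
      using that(1,2) i l unfolding path_event_def by (metis (mono_tags, lifting) mem_Collect_eq)
    then show "xs ! i = ys ! i" by simp
  qed
  then show ?thesis unfolding disjoint_family_on_def by blast
qed

text \<open>
  A step may take values other than 1 and -1, but only on a null set: there are \<open>2 ^ n\<close> path events,
  which are disjoint and of probability \<open>1 / 2 ^ n\<close> each.
\<close>

lemma AE_path_event: "AE \<omega> in M. \<omega> \<in> (\<Union>xs\<in>sign_lists n. path_event xs)"
proof (rule AE_prob_1)
  have "prob (\<Union>xs\<in>sign_lists n. path_event xs) = (\<Sum>xs\<in>sign_lists n. prob (path_event xs))"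
    using path_event_sets by (intro finite_measure_finite_Union disjoint_path_events) auto
  also have "\<dots> = 1" by (simp add: prob_path_event card_sign_lists)
  finally show "prob (\<Union>xs\<in>sign_lists n. path_event xs) = 1" .
qed

lemma expectation_returns_path:
  fixes F :: "nat \<Rightarrow> real"
  shows "(\<integral>\<omega>. F (returns X n \<omega>) \<partial>M) = (\<Sum>xs\<in>sign_lists n. F (zeros 0 xs)) / 2 ^ n"
proof -
  have meas: "(\<lambda>\<omega>. F (returns X n \<omega>)) \<in> borel_measurable M"
    by (rule measurable_compose[OF returns_measurable]) simp
  have "AE \<omega> in M. F (returns X n \<omega>) = (\<Sum>xs\<in>sign_lists n. F (zeros 0 xs) * indicator (path_event xs) \<omega>)"
    using AE_path_event[of n]
  proof eventually_elim
    case (elim \<omega>)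
    then obtain ys where ys: "ys \<in> sign_lists n" "\<omega> \<in> path_event ys" by auto
    have "(\<Sum>xs\<in>sign_lists n. F (zeros 0 xs) * indicator (path_event xs) \<omega>) =
       (\<Sum>xs\<in>{ys}. F (zeros 0 xs) * indicator (path_event xs) \<omega>)"
      using ys disjoint_path_events[of n]
      by (intro sum.mono_neutral_right) (auto simp: disjoint_family_on_def indicator_def)
    also have "\<dots> = F (returns X n \<omega>)"
      using ys returns_eq_zeros[of n X \<omega> ys] by (simp add: path_event_def sign_lists_def)
    finally show ?case ..
  qed
  then have "(\<integral>\<omega>. F (returns X n \<omega>) \<partial>M) =
      (\<integral>\<omega>. (\<Sum>xs\<in>sign_lists n. F (zeros 0 xs) * indicator (path_event xs) \<omega>) \<partial>M)"
    by (intro integral_cong_AE meas borel_measurable_sum borel_measurable_times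
          borel_measurable_indicator path_event_sets) auto
  also have "\<dots> = (\<Sum>xs\<in>sign_lists n. F (zeros 0 xs) * prob (path_event xs))"
    using path_event_sets by (subst Bochner_Integration.integral_sum)
      (auto simp: emeasure_eq_measure intro!: sum.cong integrable_mult_right)
  also have "\<dots> = (\<Sum>xs\<in>sign_lists n. F (zeros 0 xs)) / 2 ^ n"
    by (simp add: prob_path_event sum_divide_distrib)
  finally show ?thesis .
qed

lemma expectation_returns:
  fixes F :: "nat \<Rightarrow> real"
  assumes "m > 0"
  shows "(\<integral>\<omega>. F (returns X (2 * m) \<omega>) \<partial>M) = (\<Sum>r\<le>2*m. ret_prob m r * F r)"
  unfolding expectation_returns_path sum_sign_lists_zeros[OF assms] by simp

end

section \<open>Ratios, mean and central value of the return probabilities\<close>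

lemma ret_prob_nonneg: "ret_prob m r \<ge> 0"
  by (simp add: ret_prob_def)

text \<open>
  Equivalently \<open>(n - r) (p r - p (r + 1)) = r p r\<close> with \<open>n = 2 m\<close>: the discrete analogue of the
  differential equation \<open>- f' = x f\<close> of the half-normal density. Its sum over \<open>r\<close> telescopes and
  yields the mean.
\<close>

lemma ret_prob_Suc:
  assumes "r < 2 * m"
  shows "(2 * real m - real r) * ret_prob m (Suc r) = (2 * real m - 2 * real r) * ret_prob m r"
proof -
  define N where "N = 2 * m - Suc r"
  have N: "2 * m - r = Suc N" "2 * m - Suc r = N" "real (Suc N) = 2 * real m - real r"
    using assms by (auto simp: N_def)
  show ?thesis
  proof (cases "r \<le> m")
    case True
    then have "real (Suc N - m) = real m - real r" using N(1) assms by simp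
    moreover have "real (Suc N - m) * real (Suc N choose m) = real (Suc N) * real (N choose m)"
      using binomial_absorb_comp[of "Suc N" m]
      unfolding of_nat_mult[symmetric] of_nat_eq_iff diff_Suc_1 .
    ultimately have "(real m - real r) * real (Suc N choose m) = real (Suc N) * real (N choose m)"
      by (simp only:)
    then have "real (Suc N) * (real (N choose m) / 2 ^ N) =
        (real m - real r) * real (Suc N choose m) / 2 ^ N"
      by (simp del: of_nat_Suc)
    also have "\<dots> = (2 * real m - 2 * real r) * (real (Suc N choose m) / 2 ^ Suc N)"
      by (simp add: field_simps del: binomial_Suc_Suc)
    finally show ?thesis
      unfolding ret_prob_def N(1,2) N(3)[symmetric] .
  next
    case False
    then show ?thesis unfolding ret_prob_def using assms by (simp add: binomial_eq_0)
  qed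
qed

lemma ret_prob_Suc_le:
  assumes "m > 0" "r \<le> 2 * m"
  shows "ret_prob m (Suc r) \<le> exp (- real r / (2 * real m)) * ret_prob m r"
proof (cases "r < m")
  case True
  then have pos: "2 * real m - real r > 0" by simp
  have "ret_prob m (Suc r) = (2 * real m - 2 * real r) / (2 * real m - real r) * ret_prob m r"
    using ret_prob_Suc[of r m] pos True by (simp add: field_simps)
  also have "(2 * real m - 2 * real r) / (2 * real m - real r) \<le> 1 - real r / (2 * real m)"
    using pos assms True by (simp add: field_simps)
  also have "1 - real r / (2 * real m) \<le> exp (- real r / (2 * real m))"
    using exp_ge_add_one_self[of "- real r / (2 * real m)"] by simp
  finally show ?thesis by (simp add: ret_prob_nonneg mult_right_mono)
next
  case False
  then have "ret_prob m (Suc r) = 0" using assms(1) by (simp add: ret_prob_def binomial_eq_0)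
  then show ?thesis by (simp add: ret_prob_nonneg)
qed

lemma mean_ret_prob:
  assumes "m > 0"
  shows "(\<Sum>r\<le>2*m. ret_prob m r * real r) = (2 * real m + 1) * ret_prob m 0 - 1"
proof -
  let ?n = "2 * m" and ?p = "ret_prob m"
  have "r < ?n \<Longrightarrow> ?p r * real r = (real ?n - real r) * ?p r - (real ?n - real (Suc r)) * ?p (Suc r) - ?p (Suc r)" for r
    using ret_prob_Suc[of r m] by (simp add: algebra_simps)
  then have "(\<Sum>r<?n. ?p r * real r) =
     (\<Sum>r<?n. ((real ?n - real r) * ?p r - (real ?n - real (Suc r)) * ?p (Suc r)) - ?p (Suc r))"
    by (intro sum.cong) auto
  also have "\<dots> = (\<Sum>r<?n. (real ?n - real r) * ?p r - (real ?n - real (Suc r)) * ?p (Suc r)) - (\<Sum>r<?n. ?p (Suc r))"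
    by (rule sum_subtractf)
  also have "(\<Sum>r<?n. (real ?n - real r) * ?p r - (real ?n - real (Suc r)) * ?p (Suc r)) = real ?n * ?p 0"
    by (subst sum_lessThan_telescope') simp
  also have "(\<Sum>r<?n. ?p (Suc r)) = 1 - ?p 0"
    using sum_ret_prob[OF assms] sum.atMost_shift[of ?p ?n] by simp
  finally have "(\<Sum>r<?n. ?p r * real r) = (2 * real m + 1) * ?p 0 - 1" by (simp add: algebra_simps)
  moreover have "?p ?n = 0" using assms by (simp add: ret_prob_def)
  ultimately show ?thesis by (simp add: lessThan_Suc_atMost[symmetric])
qed

lemma ret_prob_0_Suc:
  "ret_prob (Suc m) 0 = (2 * real m + 1) / (2 * real m + 2) * ret_prob m 0"
proof -
  have c: "ret_prob k 0 = fact (2 * k) / (fact k * fact k * 2 ^ (2 * k))" for k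
  proof -
    have "2 * k - k = k" by simp
    then show ?thesis
      using binomial_fact[of k "2 * k", where ?'a = real] unfolding ret_prob_def by simp
  qed
  define x where "x = real m"
  have x: "x \<ge> 0" by (simp add: x_def)
  have "(fact (2 * Suc m) :: real) = (2 * x + 2) * (2 * x + 1) * fact (2 * m)"
    by (simp add: x_def algebra_simps)
  moreover have "(fact (Suc m) :: real) = (x + 1) * fact m" by (simp add: x_def)
  moreover have "(2::real) ^ (2 * Suc m) = 4 * 2 ^ (2 * m)" by simp
  ultimately have "ret_prob (Suc m) 0 =
      (2 * x + 2) * (2 * x + 1) * fact (2 * m) / ((x + 1) * fact m * ((x + 1) * fact m) * (4 * 2 ^ (2 * m)))"
    unfolding c[of "Suc m"] by (simp only:)
  also have "\<dots> = (2 * x + 2) * (2 * x + 1) / ((x + 1) * (x + 1) * 4) * ret_prob m 0"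
    unfolding c[of m] by (simp add: mult_ac)
  also have "(2 * x + 2) * (2 * x + 1) / ((x + 1) * (x + 1) * 4) = (2 * x + 1) / (2 * x + 2)"
    using x by (simp add: divide_simps) (simp add: algebra_simps)
  finally show ?thesis unfolding x_def .
qed

lemma ret_prob_0_pos: "ret_prob m 0 > 0"
  by (simp add: ret_prob_def)

text \<open>
  Wallis' product increases to \<open>pi / 2\<close>, whereas its product with \<open>(2 m + 1) / (2 m)\<close> decreases to
  the same limit. The two monotone limits give the lower and the upper bound on the central
  probability below.
\<close>

lemma wallis_ret_prob:
  "(\<Prod>k=1..m. (4 * real k ^ 2) / (4 * real k ^ 2 - 1)) = 1 / ((2 * real m + 1) * ret_prob m 0 ^ 2)"
proof (induction m)
  case 0
  then show ?case by (simp add: ret_prob_def)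
next
  case (Suc m)
  define x p where "x = real m" and "p = ret_prob m 0"
  have x: "x \<ge> 0" and p: "p > 0" by (simp_all add: x_def p_def ret_prob_0_pos)
  have f: "4 * real (Suc m) ^ 2 = (2 * x + 2)\<^sup>2" "(2 * x + 2)\<^sup>2 - 1 = (2 * x + 1) * (2 * x + 3)"
    by (simp_all add: x_def power2_eq_square algebra_simps)
  have g: "2 * real (Suc m) + 1 = 2 * x + 3" by (simp add: x_def)
  have q: "ret_prob (Suc m) 0 = (2 * x + 1) / (2 * x + 2) * p"
    unfolding ret_prob_0_Suc by (simp add: x_def p_def)
  have "1 / ((2 * x + 1) * p\<^sup>2) * ((2 * x + 2)\<^sup>2 / ((2 * x + 1) * (2 * x + 3))) =
      1 / ((2 * x + 3) * ((2 * x + 1) / (2 * x + 2) * p)\<^sup>2)"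
    using x p by (simp add: power_mult_distrib power_divide) (simp add: power2_eq_square)
  moreover have "(\<Prod>k=1..Suc m. (4 * real k ^ 2) / (4 * real k ^ 2 - 1)) =
      (\<Prod>k=1..m. (4 * real k ^ 2) / (4 * real k ^ 2 - 1)) * ((2 * x + 2)\<^sup>2 / ((2 * x + 1) * (2 * x + 3)))"
    unfolding f(2)[symmetric] f(1)[symmetric] by simp
  ultimately show ?case
    unfolding q g Suc.IH x_def[symmetric] p_def[symmetric] by simp
qed

lemma ret_prob_0_lower: "ret_prob m 0 ^ 2 \<ge> 2 / (pi * (2 * real m + 1))"
proof -
  let ?w = "\<lambda>m. \<Prod>k=1..m. (4 * real k ^ 2) / (4 * real k ^ 2 - 1)"
  have pos: "?w m > 0" for m unfolding wallis_ret_prob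
    by (intro divide_pos_pos mult_pos_pos zero_less_power ret_prob_0_pos) auto
  have "?w m \<le> ?w (Suc m)" for m
  proof -
    have "4 * real (Suc m) ^ 2 - 1 > 0" by (simp add: power2_eq_square algebra_simps add_pos_nonneg)
    then have "(4 * real (Suc m) ^ 2) / (4 * real (Suc m) ^ 2 - 1) \<ge> 1" by simp
    then have "?w m * 1 \<le> ?w m * ((4 * real (Suc m) ^ 2) / (4 * real (Suc m) ^ 2 - 1))"
      using pos[of m] by (intro mult_left_mono) auto
    then show ?thesis by simp
  qed
  then have "incseq ?w" by (rule incseq_SucI)
  then have "?w m \<le> pi / 2" using wallis by (rule incseq_le)
  then have w: "1 / ((2 * real m + 1) * ret_prob m 0 ^ 2) \<le> pi / 2" unfolding wallis_ret_prob .
  have "2 / (pi * a) \<le> q" if "1 / (a * q) \<le> pi / 2" "a > 0" "q > 0" for a q :: real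
    using that by (simp add: field_simps)
  from this[OF w] show ?thesis using ret_prob_0_pos[of m] by simp
qed

lemma ret_prob_0_upper:
  assumes "m > 0"
  shows "ret_prob m 0 ^ 2 \<le> 1 / (pi * real m)"
proof -
  let ?w = "\<lambda>m. \<Prod>k=1..m. (4 * real k ^ 2) / (4 * real k ^ 2 - 1)"
  \<comment> \<open>The decreasing sequence, shifted by one so that its denominator never vanishes.\<close>
  define v where "v m = 1 / ((2 * real m + 2) * ret_prob (Suc m) 0 ^ 2)" for m
  have v: "v m = ?w (Suc m) * ((2 * real m + 3) / (2 * real m + 2))" for m
    unfolding wallis_ret_prob v_def by (simp add: divide_simps)
  have "v (Suc m) \<le> v m" for m
  proof -
    have q: "ret_prob (Suc (Suc m)) 0 = (2 * real m + 3) / (2 * real m + 4) * ret_prob (Suc m) 0"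
      unfolding ret_prob_0_Suc[of "Suc m"] by (simp add: algebra_simps)
    have "(2 * real m + 4) * ret_prob (Suc (Suc m)) 0 ^ 2 =
       ((2 * real m + 3)\<^sup>2 / (2 * real m + 4)) * ret_prob (Suc m) 0 ^ 2"
      unfolding q power_mult_distrib power_divide by (simp add: power2_eq_square)
    moreover have "(2 * real m + 3)\<^sup>2 / (2 * real m + 4) \<ge> 2 * real m + 2"
      by (simp add: divide_simps power2_eq_square algebra_simps)
    ultimately have le: "(2 * real m + 2) * ret_prob (Suc m) 0 ^ 2 \<le> (2 * real m + 4) * ret_prob (Suc (Suc m)) 0 ^ 2"
      by (simp only: mult_right_mono zero_le_power2)
    have pos: "0 < (2 * real m + 2) * ret_prob (Suc m) 0 ^ 2"
      by (intro mult_pos_pos zero_less_power ret_prob_0_pos) auto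
    have e: "2 * real (Suc m) + 2 = 2 * real m + 4" by simp
    show ?thesis unfolding v_def e by (rule frac_le[OF _ _ pos le]) auto
  qed
  then have dec: "decseq v" by (rule decseq_SucI)
  have "(\<lambda>m. (2 * real m + 3) / (2 * real m + 2)) \<longlonglongrightarrow> 1" by real_asymp
  with LIMSEQ_Suc[OF wallis] have "v \<longlonglongrightarrow> pi / 2 * 1"
    unfolding v by (rule tendsto_mult)
  from decseq_ge[OF dec this, of "m - 1"] have "pi / 2 \<le> v (m - 1)" by simp
  also have "v (m - 1) = 1 / (2 * real m * ret_prob m 0 ^ 2)"
    using assms by (cases m) (simp_all add: v_def)
  finally have w: "pi / 2 \<le> 1 / (2 * real m * ret_prob m 0 ^ 2)" .
  have "q \<le> 1 / (pi * a)" if "pi / 2 \<le> 1 / (2 * a * q)" "a > 0" "q > 0" for a q :: real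
    using that by (simp add: field_simps)
  from this[OF w] show ?thesis using assms ret_prob_0_pos[of m] by simp
qed

lemma ret_prob_0_le: "m > 0 \<Longrightarrow> ret_prob m 0 \<le> sqrt (2 / (pi * real (2 * m)))"
  using ret_prob_0_upper[of m] by (intro real_le_rsqrt) simp

lemma mean_ret_prob_ge:
  assumes "m > 0"
  shows "(\<Sum>r\<le>2*m. ret_prob m r * real r) \<ge> sqrt (2 * real (2*m) / pi) - 1"
proof -
  have "2 * real (2*m) / pi \<le> 2 * (2 * real m + 1) / pi"
    by (intro divide_right_mono) auto
  also have "\<dots> = (2 * real m + 1)\<^sup>2 * (2 / (pi * (2 * real m + 1)))"
    by (simp add: power2_eq_square)
  also have "\<dots> \<le> (2 * real m + 1)\<^sup>2 * ret_prob m 0 ^ 2"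
    by (intro mult_left_mono ret_prob_0_lower) simp
  also have "\<dots> = ((2 * real m + 1) * ret_prob m 0)\<^sup>2" by (simp add: power_mult_distrib)
  finally have "sqrt (2 * real (2*m) / pi) \<le> (2 * real m + 1) * ret_prob m 0"
    using ret_prob_0_pos[of m] by (intro real_le_lsqrt) auto
  then show ?thesis unfolding mean_ret_prob[OF assms] by simp
qed

section \<open>The scaled half-normal density on unit intervals\<close>

text \<open>
  On the nonnegative reals, the density of \<open>sqrt n\<close> times a half-normal variable.
\<close>

definition half_normal_density :: "nat \<Rightarrow> real \<Rightarrow> real" where
  "half_normal_density n x = sqrt (2 / (pi * real n)) * exp (- x\<^sup>2 / (2 * real n))"

lemma half_normal_density_pos: "n > 0 \<Longrightarrow> half_normal_density n x > 0"
  by (simp add: half_normal_density_def)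

lemma half_normal_density_continuous [continuous_intros]: "continuous_on A (half_normal_density n)"
proof (cases "n = 0")
  case True
  then show ?thesis unfolding half_normal_density_def by simp
next
  case False
  then show ?thesis unfolding half_normal_density_def by (intro continuous_intros) simp
qed

lemma half_normal_density_measurable [measurable]: "half_normal_density n \<in> borel_measurable borel"
  by (rule borel_measurable_continuous_onI) (rule half_normal_density_continuous)

lemma half_normal_density_antimono:
  assumes "0 \<le> x" "x \<le> y"
  shows "half_normal_density n y \<le> half_normal_density n x"
proof -
  have "x\<^sup>2 \<le> y\<^sup>2" using assms by (intro power_mono) auto
  then show ?thesis unfolding half_normal_density_def by (intro mult_left_mono) (auto simp: divide_right_mono)
qed

lemma half_normal_density_integrable_on: "(\<lambda>x. half_normal_density n x) integrable_on {a..b}"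
  by (intro integrable_continuous_interval continuous_intros)

text \<open>
  For \<open>r \<ge> 1\<close>, the probability that the scaled half-normal variable, rounded up, equals \<open>r\<close>.
\<close>

definition cell :: "nat \<Rightarrow> nat \<Rightarrow> real" where
  "cell n r = integral {real r - 1..real r} (half_normal_density n)"

lemma integral_centred: "integral {c - 1/2..c + 1/2} (\<lambda>x. (x - c) * k) = (0::real)"
proof -
  have "((\<lambda>x. (x - c) * k) has_integral ((c + 1/2 - c)\<^sup>2 / 2 * k - (c - 1/2 - c)\<^sup>2 / 2 * k)) {c - 1/2..c + 1/2}"
    by (rule fundamental_theorem_of_calculus)
       (auto intro!: derivative_eq_intros simp: has_real_derivative_iff_has_vector_derivative[symmetric])
  then have "integral {c - 1/2..c + 1/2} (\<lambda>x. (x - c) * k) = (c + 1/2 - c)\<^sup>2 / 2 * k - (c - 1/2 - c)\<^sup>2 / 2 * k"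
    by (rule integral_unique)
  also have "\<dots> = 0" by (simp add: power2_eq_square)
  finally show ?thesis .
qed

lemma integral_centred_cell: "integral {real r - 1..real r} (\<lambda>x. (x - (real r - 1/2)) * k) = 0"
  using integral_centred[of "real r - 1/2" k] by simp

text \<open>
  Shifting \<open>x\<close> by 1 multiplies the density by \<open>exp (- (2 x + 1) / (2 n))\<close>. At the midpoint
  \<open>x = r - 1 / 2\<close> of the interval this factor is \<open>exp (- r / n)\<close>; by convexity it lies above its
  tangent there, and the linear term of the tangent helps because the decreasing density puts
  more mass left of the midpoint.
\<close>

lemma cell_Suc_ge:
  assumes "n > 0" "r \<ge> 1"
  shows "cell n (Suc r) \<ge> exp (- real r / real n) * cell n r"
proof -
  define c where "c = real r - 1 / 2"
  have c: "c \<ge> 0" using assms by (simp add: c_def)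
  define k where "k = half_normal_density n c / real n"
  have pt: "half_normal_density n (x + 1) \<ge> exp (- real r / real n) * (half_normal_density n x - (x - c) * k)"
    if x: "x \<in> {real r - 1..real r}" for x
  proof -
    have x0: "x \<ge> 0" using x assms by simp
    \<comment> \<open>The exponent of the shift factor relative to its value at the midpoint.\<close>
    define u where "u = - (x - c) / real n"
    have "- (x + 1)\<^sup>2 / (2 * real n) = - real r / real n + (u + - x\<^sup>2 / (2 * real n))"
      using assms by (simp add: u_def c_def field_simps power2_eq_square)
    then have eq: "half_normal_density n (x + 1) = exp (- real r / real n) * (exp u * half_normal_density n x)"
      unfolding half_normal_density_def by (simp only: exp_add mult_ac)
    have "(1 + u) * half_normal_density n x \<le> exp u * half_normal_density n x"
      using half_normal_density_pos[OF assms(1), of x] exp_ge_add_one_self[of u] by (intro mult_right_mono) auto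
    moreover have "(x - c) * half_normal_density n x \<le> (x - c) * half_normal_density n c"
    proof (cases "x \<ge> c")
      case True
      then show ?thesis using half_normal_density_antimono[of c x n] c by (intro mult_left_mono) auto
    next
      case False
      then show ?thesis using half_normal_density_antimono[of x c n] x0 by (intro mult_left_mono_neg) auto
    qed
    then have "(x - c) * half_normal_density n x / real n \<le> (x - c) * half_normal_density n c / real n"
      by (rule divide_right_mono) simp
    then have "half_normal_density n x - (x - c) * k \<le> (1 + u) * half_normal_density n x"
    proof -
      have "u * half_normal_density n x = - ((x - c) * half_normal_density n x / real n)" "(x - c) * k = (x - c) * half_normal_density n c / real n"
        using assms by (simp_all add: u_def k_def field_simps)
      then show ?thesis
        using \<open>(x - c) * half_normal_density n x / real n \<le> (x - c) * half_normal_density n c / real n\<close>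
        by (simp add: distrib_right)
    qed
    ultimately have "half_normal_density n x - (x - c) * k \<le> exp u * half_normal_density n x" by linarith
    then show ?thesis unfolding eq by (intro mult_left_mono) auto
  qed
  have "cell n (Suc r) = integral {real r - 1..real r} (\<lambda>x. half_normal_density n (x + 1))"
    using integral_shift[of "real r - 1" 1 "real r" "half_normal_density n"] half_normal_density_continuous
    unfolding cell_def by (simp add: o_def add_ac)
  moreover have "integral {real r - 1..real r} (\<lambda>x. exp (- real r / real n) * (half_normal_density n x - (x - c) * k)) \<le> \<dots>"
    by (intro integral_le pt integrable_continuous_interval continuous_intros
       continuous_on_compose2[OF half_normal_density_continuous[of UNIV]]) auto
  moreover have "integral {real r - 1..real r} (\<lambda>x. exp (- real r / real n) * (half_normal_density n x - (x - c) * k)) =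
     exp (- real r / real n) * (integral {real r - 1..real r} (\<lambda>x. half_normal_density n x) - integral {real r - 1..real r} (\<lambda>x. (x - c) * k))"
    unfolding integral_mult_right
    by (subst integral_diff) (auto intro!: integrable_continuous_interval continuous_intros)
  ultimately show ?thesis unfolding cell_def c_def integral_centred_cell by simp
qed

text \<open>
  A constant density would give exactly half of the mass of the interval. The deviation from the value
  at the midpoint is bounded by the oscillation of the density on the interval, and these
  oscillations telescope when the intervals are added up.
\<close>

lemma cell_overshoot:
  assumes "r \<ge> 1"
  shows "integral {real r - 1..real r} (\<lambda>x. (real r - x) * half_normal_density n x) \<le> 
           cell n r / 2 + (half_normal_density n (real r - 1) - half_normal_density n (real r)) / 2"
proof -
  define c where "c = real r - 1 / 2"
  define d where "d = (half_normal_density n (real r - 1) - half_normal_density n (real r)) / 2"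
  have c: "c \<ge> 0" using assms by (simp add: c_def)
  have pt: "(real r - x) * half_normal_density n x \<le> half_normal_density n x / 2 - (x - c) * half_normal_density n c + d"
    if x: "x \<in> {real r - 1..real r}" for x
  proof -
    have x0: "x \<ge> 0" using x assms by simp
    have b: "\<bar>half_normal_density n x - half_normal_density n c\<bar> \<le> 2 * d"
    proof -
      have "half_normal_density n (real r) \<le> half_normal_density n x" "half_normal_density n x \<le> half_normal_density n (real r - 1)"
        "half_normal_density n (real r) \<le> half_normal_density n c" "half_normal_density n c \<le> half_normal_density n (real r - 1)"
        using x x0 c assms by (auto intro!: half_normal_density_antimono simp: c_def)
      moreover have "2 * d = half_normal_density n (real r - 1) - half_normal_density n (real r)" by (simp add: d_def)
      ultimately show ?thesis by linarith
    qed
    have "(c - x) * (half_normal_density n x - half_normal_density n c) \<le> \<bar>c - x\<bar> * \<bar>half_normal_density n x - half_normal_density n c\<bar>"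
      by (metis abs_ge_self abs_mult)
    also have "\<dots> \<le> 1 / 2 * (2 * d)"
    proof (intro mult_mono b)
      show "\<bar>c - x\<bar> \<le> 1 / 2" by (rule abs_leI) (use x in \<open>auto simp: c_def\<close>)
    qed auto
    finally show ?thesis by (simp add: c_def algebra_simps)
  qed
  have "integral {real r - 1..real r} (\<lambda>x. (real r - x) * half_normal_density n x) \<le>
     integral {real r - 1..real r} (\<lambda>x. half_normal_density n x / 2 - (x - c) * half_normal_density n c + d)"
    by (intro integral_le pt integrable_continuous_interval continuous_intros) auto
  also have "\<dots> = integral {real r - 1..real r} (\<lambda>x. half_normal_density n x / 2) - 
       integral {real r - 1..real r} (\<lambda>x. (x - c) * half_normal_density n c) + integral {real r - 1..real r} (\<lambda>x. d)"
    by (subst integral_add, (auto intro!: integrable_continuous_interval continuous_intros)[2],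
        subst integral_diff) (auto intro!: integrable_continuous_interval continuous_intros)
  also have "\<dots> = cell n r / 2 + d"
    unfolding c_def integral_centred_cell cell_def by simp
  finally show ?thesis unfolding d_def .
qed

lemma cell_ge:
  assumes "r \<ge> 1"
  shows "half_normal_density n (real r) \<le> cell n r"
proof -
  have "integral {real r - 1..real r} (\<lambda>x. half_normal_density n (real r)) \<le> integral {real r - 1..real r} (half_normal_density n)"
    using assms by (intro integral_le half_normal_density_integrable_on half_normal_density_antimono) auto
  then show ?thesis unfolding cell_def by simp
qed

section \<open>The scaled half-normal variable and its rounding\<close>

lemma nn_integral_abs_even:
  fixes f :: "real \<Rightarrow> ennreal"
  assumes [measurable]: "f \<in> borel_measurable borel"
  shows "(\<integral>\<^sup>+x. f \<bar>x\<bar> \<partial>lborel) = (\<integral>\<^sup>+x. 2 * f x * indicator {0..} x \<partial>lborel)"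
proof -
  have "(\<integral>\<^sup>+x. f \<bar>x\<bar> \<partial>lborel) = (\<integral>\<^sup>+x. f x * indicator {0..} x + f (- x) * indicator {..<0} x \<partial>lborel)"
    by (intro nn_integral_cong) (auto simp: indicator_def)
  also have "\<dots> = (\<integral>\<^sup>+x. f x * indicator {0..} x \<partial>lborel) + (\<integral>\<^sup>+x. f (- x) * indicator {..<0} x \<partial>lborel)"
    by (rule nn_integral_add) auto
  also have "(\<integral>\<^sup>+x. f (- x) * indicator {..<0} x \<partial>lborel) = (\<integral>\<^sup>+x. f x * indicator {..<0} (- x) \<partial>lborel)"
    by (subst nn_integral_real_affine[where c = "-1" and t = 0]) auto
  also have "\<dots> = (\<integral>\<^sup>+x. f x * indicator {0..} x \<partial>lborel)"
    by (intro nn_integral_cong_AE eventually_mono[OF AE_lborel_singleton[of 0]])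
       (auto simp: indicator_def)
  finally show ?thesis
    by (subst (asm) nn_integral_add[symmetric]) (auto simp: mult_2 distrib_right)
qed

lemma half_normal_density_eq: "n > 0 \<Longrightarrow> half_normal_density n x = 2 * normal_density 0 (sqrt (real n)) x"
proof -
  have "sqrt (2 / (pi * real n)) = sqrt (4 / (2 * pi * real n))" by simp
  also have "\<dots> = 2 / sqrt (2 * pi * real n)" by (simp only: real_sqrt_divide real_sqrt_four)
  finally show "n > 0 \<Longrightarrow> half_normal_density n x = 2 * normal_density 0 (sqrt (real n)) x"
    unfolding half_normal_density_def normal_density_def by simp
qed

lemma distributed_scaled_abs_normal:
  assumes "prob_space N" "distributed N lborel Z std_normal_density" "n > 0"
  shows "distributed N lborel (\<lambda>y. sqrt (real n) * \<bar>Z y\<bar>) (\<lambda>x. ennreal (half_normal_density n x * indicator {0..} x))"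
proof -
  interpret prob_space N by fact
  define U where "U y = sqrt (real n) * Z y" for y
  let ?\<phi> = "normal_density 0 (sqrt (real n))"
  have U: "distributed N lborel U ?\<phi>"
    using normal_density_affine[OF assms(2), of "sqrt (real n)" 0] assms(3)
    by (simp add: U_def[abs_def])
  then have Um[measurable]: "U \<in> borel_measurable N"
    using distributed_measurable[OF U] by simp
  have V: "(\<lambda>y. sqrt (real n) * \<bar>Z y\<bar>) = (\<lambda>y. \<bar>U y\<bar>)"
    by (simp add: U_def abs_mult fun_eq_iff)
  have "distr N lborel (\<lambda>y. \<bar>U y\<bar>) = density lborel (\<lambda>x. ennreal (half_normal_density n x * indicator {0..} x))"
  proof (rule measure_eqI)
    fix A assume "A \<in> sets (distr N lborel (\<lambda>y. \<bar>U y\<bar>))"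
    then have A[measurable]: "A \<in> sets borel" by simp
    have "emeasure (distr N lborel (\<lambda>y. \<bar>U y\<bar>)) A = emeasure N (U -` ((\<lambda>x. \<bar>x\<bar>) -` A) \<inter> space N)"
      by (subst emeasure_distr) (auto intro!: arg_cong[where f = "emeasure N"])
    also have "\<dots> = (\<integral>\<^sup>+x. ennreal (?\<phi> x) * indicator ((\<lambda>x. \<bar>x\<bar>) -` A) x \<partial>lborel)"
      by (rule distributed_emeasure[OF U]) (use measurable_sets_borel[of "\<lambda>x::real. \<bar>x\<bar>" borel A] in auto)
    also have "\<dots> = (\<integral>\<^sup>+x. ennreal (?\<phi> \<bar>x\<bar>) * indicator A \<bar>x\<bar> \<partial>lborel)"
      by (intro nn_integral_cong) (auto simp: normal_density_def indicator_def)
    also have "\<dots> = (\<integral>\<^sup>+x. 2 * (ennreal (?\<phi> x) * indicator A x) * indicator {0..} x \<partial>lborel)"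
      by (rule nn_integral_abs_even) simp
    also have "\<dots> = (\<integral>\<^sup>+x. ennreal (half_normal_density n x * indicator {0..} x) * indicator A x \<partial>lborel)"
      using assms(3) by (intro nn_integral_cong)
       (auto simp: half_normal_density_eq ennreal_mult indicator_def)
    also have "\<dots> = emeasure (density lborel (\<lambda>x. ennreal (half_normal_density n x * indicator {0..} x))) A"
      by (subst emeasure_density) auto
    finally show "emeasure (distr N lborel (\<lambda>y. \<bar>U y\<bar>)) A = \<dots>" .
  qed simp
  then show ?thesis unfolding distributed_def V by simp
qed

locale half_normal = prob_space N for N :: "'b measure" +
  fixes Z :: "'b \<Rightarrow> real" and n :: nat
  assumes Z_distributed: "distributed N lborel Z std_normal_density"
    and n_pos: "n > 0"
begin

definition V :: "'b \<Rightarrow> real" where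
  "V y = sqrt (real n) * \<bar>Z y\<bar>"

lemma V_distributed: "distributed N lborel V (\<lambda>x. ennreal (half_normal_density n x * indicator {0..} x))"
  using distributed_scaled_abs_normal[OF prob_space_axioms Z_distributed n_pos]
  unfolding V_def[abs_def] .

lemma V_measurable [measurable]: "V \<in> borel_measurable N"
  using distributed_measurable[OF V_distributed] by simp

lemma V_expectation:
  assumes "g \<in> borel_measurable borel"
  shows "(\<integral>y. g (V y) \<partial>N) = (\<integral>x. half_normal_density n x * indicator {0..} x * g x \<partial>lborel)"
  using assms half_normal_density_pos[OF n_pos]
  by (intro distributed_integral[OF V_distributed, symmetric]) (auto simp: less_imp_le)

lemma AE_V_pos: "AE y in N. 0 < V y"
proof -
  have "AE x in lborel. 0 < ennreal (half_normal_density n x * indicator {0..} x) \<longrightarrow> 0 < x"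
    by (rule eventually_mono[OF AE_lborel_singleton[of 0]]) (auto simp: indicator_def)
  then have "AE x in distr N lborel V. 0 < x"
    unfolding distributed_distr_eq_density[OF V_distributed]
    by (subst AE_density) auto
  then show ?thesis by (subst (asm) AE_distr_iff) auto
qed

lemma V_interval_expectation:
  assumes "0 \<le> a" "continuous_on UNIV g"
  shows "(\<integral>y. g (V y) * indicator {a<..b} (V y) \<partial>N) = integral {a..b} (\<lambda>x. g x * half_normal_density n x)"
proof -
  have [measurable]: "g \<in> borel_measurable borel"
    using assms(2) by (rule borel_measurable_continuous_onI)
  have "(\<integral>y. g (V y) * indicator {a<..b} (V y) \<partial>N) =
      (\<integral>x. half_normal_density n x * indicator {0..} x * (g x * indicator {a<..b} x) \<partial>lborel)"
    by (rule V_expectation) simp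
  also have "\<dots> = (LBINT x:{a..b}. g x * half_normal_density n x)"
    unfolding set_lebesgue_integral_def
    by (intro integral_cong_AE eventually_mono[OF AE_lborel_singleton[of a]])
       (use assms(1) in \<open>auto simp: indicator_def\<close>)
  also have "\<dots> = integral {a..b} (\<lambda>x. g x * half_normal_density n x)"
    by (intro set_borel_integral_eq_integral borel_integrable_atLeastAtMost')
       (auto intro!: continuous_intros continuous_on_subset[OF assms(2)])
  finally show ?thesis .
qed

lemma prob_V_interval:
  assumes "0 \<le> a"
  shows "prob {y \<in> space N. a < V y \<and> V y \<le> b} = integral {a..b} (half_normal_density n)"
proof -
  have "prob {y \<in> space N. a < V y \<and> V y \<le> b} = (\<integral>y. indicator {y \<in> space N. a < V y \<and> V y \<le> b} y \<partial>N)"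
    by simp
  also have "\<dots> = (\<integral>y. 1 * indicator {a<..b} (V y) \<partial>N)"
    by (intro Bochner_Integration.integral_cong) (auto simp: indicator_def)
  also have "\<dots> = integral {a..b} (\<lambda>x. 1 * half_normal_density n x)"
    by (rule V_interval_expectation[OF assms]) simp
  finally show ?thesis by simp
qed

lemma prob_V_le: "prob {y \<in> space N. V y \<le> b} = integral {0..b} (half_normal_density n)"
proof -
  have "prob {y \<in> space N. V y \<le> b} = prob {y \<in> space N. 0 < V y \<and> V y \<le> b}"
    by (rule finite_measure_eq_AE) (use AE_V_pos in auto)
  then show ?thesis using prob_V_interval[of 0 b] by simp
qed

definition C :: "'b \<Rightarrow> nat" where
  "C y = nat \<lceil>V y\<rceil>"

lemma C_measurable [measurable]: "C \<in> measurable N (count_space UNIV)"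
  unfolding C_def by measurable

text \<open>
  The positive half-line is partitioned into the intervals \<open>(r - 1, r]\<close>, on which \<open>C = r\<close>; this turns
  expectations of \<open>C\<close> and \<open>V\<close> into finite sums of integrals over unit intervals.
\<close>

lemma sum_cells:
  fixes F :: "nat \<Rightarrow> real"
  assumes "0 < V y"
  shows "(\<Sum>r=1..R. F r * indicator {real r - 1<..real r} (V y)) = F (C y) * indicator {..real R} (V y)"
proof -
  have "\<lceil>V y\<rceil> > 0" using assms by simp
  then have C: "int (C y) = \<lceil>V y\<rceil>" "C y \<ge> 1" unfolding C_def by linarith+
  have ind: "indicator {real r - 1<..real r} (V y) = (if r = C y then 1 else 0 :: real)" for r
  proof -
    have "V y \<in> {real r - 1<..real r} \<longleftrightarrow> \<lceil>V y\<rceil> = int r"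
      by (simp add: ceiling_eq_iff)
    also have "\<dots> \<longleftrightarrow> r = C y" using C(1) by auto
    finally show ?thesis by (simp add: indicator_def)
  qed
  have "V y \<le> real R \<longleftrightarrow> C y \<le> R"
    using C(1) ceiling_le_iff[of "V y" "int R"] by (metis of_int_of_nat_eq of_nat_le_iff)
  then have R: "indicator {..real R} (V y) = (if C y \<le> R then 1 else 0 :: real)"
    by (simp add: indicator_def)
  have "(\<Sum>r=1..R. F r * indicator {real r - 1<..real r} (V y)) = (\<Sum>r=1..R. if r = C y then F r else 0)"
    by (intro sum.cong) (auto simp: ind)
  also have "\<dots> = F (C y) * indicator {..real R} (V y)"
    using C(2) unfolding R by (subst sum.delta) auto
  finally show ?thesis .
qed

lemma expectation_C_upto:
  fixes F :: "nat \<Rightarrow> real \<Rightarrow> real"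
  assumes F: "\<And>r. continuous_on UNIV (F r)"
  shows "(\<integral>y. F (C y) (V y) * indicator {..real R} (V y) \<partial>N) =
    (\<Sum>r=1..R. integral {real r - 1..real r} (\<lambda>x. F r x * half_normal_density n x))"
proof -
  have [measurable]: "F r \<in> borel_measurable borel" for r
    using F by (rule borel_measurable_continuous_onI)
  have int: "integrable N (\<lambda>y. F r (V y) * indicator {real r - 1<..real r} (V y))" for r
  proof -
    have "compact (F r ` {real r - 1..real r})"
      by (intro compact_continuous_image continuous_on_subset[OF F]) auto
    then have "bounded (F r ` {real r - 1..real r})" by (rule compact_imp_bounded)
    then obtain B where "\<And>z. z \<in> F r ` {real r - 1..real r} \<Longrightarrow> norm z \<le> B"
      unfolding bounded_iff by blast
    then have B: "\<bar>F r x\<bar> \<le> B" if "real r - 1 \<le> x" "x \<le> real r" for x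
      using that by force
    have "0 \<le> B" using B[of "real r"] by (simp add: order_trans[OF abs_ge_zero])
    then show ?thesis
      by (intro integrable_const_bound[where B = B]) (use B in \<open>auto simp: indicator_def\<close>)
  qed
  have [measurable]: "(\<lambda>y. F (C y) (V y)) \<in> borel_measurable N"
    by (rule measurable_compose_countable[OF _ C_measurable]) measurable
  have "(\<integral>y. F (C y) (V y) * indicator {..real R} (V y) \<partial>N) =
     (\<integral>y. (\<Sum>r=1..R. F r (V y) * indicator {real r - 1<..real r} (V y)) \<partial>N)"
  proof (rule integral_cong_AE)
    show "AE y in N. F (C y) (V y) * indicator {..real R} (V y) =
        (\<Sum>r=1..R. F r (V y) * indicator {real r - 1<..real r} (V y))"
      using AE_V_pos
    proof eventually_elim
      case (elim y)
      show ?case by (rule sum_cells[OF elim, symmetric])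
    qed
  qed measurable
  also have "\<dots> = (\<Sum>r=1..R. \<integral>y. F r (V y) * indicator {real r - 1<..real r} (V y) \<partial>N)"
    by (rule Bochner_Integration.integral_sum) (rule int)
  also have "\<dots> = (\<Sum>r=1..R. integral {real r - 1..real r} (\<lambda>x. F r x * half_normal_density n x))"
    by (intro sum.cong refl V_interval_expectation F) auto
  finally show ?thesis .
qed

lemma sum_cell: "(\<Sum>r=1..R. cell n r) = prob {y \<in> space N. V y \<le> real R}"
proof -
  have "(\<Sum>r=1..R. cell n r) = (\<integral>y. 1 * indicator {..real R} (V y) \<partial>N)"
    unfolding cell_def using expectation_C_upto[of "\<lambda>_ _. 1" R] by simp
  also have "\<dots> = (\<integral>y. indicator {y \<in> space N. V y \<le> real R} y \<partial>N)"
    by (intro Bochner_Integration.integral_cong) (auto simp: indicator_def)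
  finally show ?thesis by simp
qed

lemma overshoot_bounds:
  "0 < V y \<Longrightarrow> 0 \<le> real (C y) - V y" "0 < V y \<Longrightarrow> real (C y) - V y \<le> 1"
  unfolding C_def using of_int_ceiling_le_add_one[of "V y"] le_of_int_ceiling[of "V y"] by linarith+

lemma overshoot_integrable: "integrable N (\<lambda>y. real (C y) - V y)"
  by (rule integrable_const_bound[where B = 1])
     (use AE_V_pos overshoot_bounds in \<open>auto elim!: eventually_mono\<close>)

text \<open>
  The bounds on the unit intervals up to \<open>R\<close> add up to half of a probability plus half of a
  telescoping sum that is at most the value of the density at 0; then \<open>R\<close> tends to infinity.
\<close>

lemma mean_overshoot: "(\<integral>y. real (C y) - V y \<partial>N) \<le> 1 / 2 + half_normal_density n 0 / 2"
proof (rule LIMSEQ_le_const2)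
  let ?E = "\<lambda>R. (\<integral>y. (real (C y) - V y) * indicator {..real R} (V y) \<partial>N)"
  show "?E \<longlonglongrightarrow> (\<integral>y. real (C y) - V y \<partial>N)"
  proof (rule integral_dominated_convergence[where w = "\<lambda>y. \<bar>real (C y) - V y\<bar>"])
    show "integrable N (\<lambda>y. \<bar>real (C y) - V y\<bar>)" using overshoot_integrable by auto
    show "AE y in N. (\<lambda>R. (real (C y) - V y) * indicator {..real R} (V y)) \<longlonglongrightarrow> real (C y) - V y"
    proof (rule AE_I2)
      fix y
      obtain k where k: "V y \<le> real k" using real_arch_simple by blast
      have "eventually (\<lambda>R. (real (C y) - V y) * indicator {..real R} (V y) = real (C y) - V y) sequentially"
        using eventually_ge_at_top[of k] by eventually_elim (use k in \<open>auto simp: indicator_def\<close>)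
      then show "(\<lambda>R. (real (C y) - V y) * indicator {..real R} (V y)) \<longlonglongrightarrow> real (C y) - V y"
        by (rule tendsto_eventually)
    qed
  qed (auto simp: indicator_def)
  have "?E R \<le> 1 / 2 + half_normal_density n 0 / 2" for R
  proof -
    have "?E R = (\<Sum>r=1..R. integral {real r - 1..real r} (\<lambda>x. (real r - x) * half_normal_density n x))"
      by (rule expectation_C_upto) (intro continuous_intros)
    also have "\<dots> \<le> (\<Sum>r=1..R. cell n r / 2 + (half_normal_density n (real r - 1) - half_normal_density n (real r)) / 2)"
      by (intro sum_mono cell_overshoot) auto
    also have "\<dots> = (\<Sum>r=1..R. cell n r) / 2 + (\<Sum>r=1..R. half_normal_density n (real r - 1) - half_normal_density n (real r)) / 2"
      by (simp only: sum.distrib sum_divide_distrib)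
    also have "(\<Sum>r=1..R. half_normal_density n (real r - 1) - half_normal_density n (real r)) = half_normal_density n 0 - half_normal_density n (real R)"
      by (induction R) auto
    finally have "?E R \<le> (\<Sum>r=1..R. cell n r) / 2 + (half_normal_density n 0 - half_normal_density n (real R)) / 2" .
    moreover have "(\<Sum>r=1..R. cell n r) \<le> 1" unfolding sum_cell by (rule prob_le_1)
    ultimately show ?thesis using half_normal_density_pos[OF n_pos, of "real R"]
      by (simp add: field_simps)
  qed
  then show "\<exists>k. \<forall>R\<ge>k. ?E R \<le> 1 / 2 + half_normal_density n 0 / 2" by blast
qed

lemma V_integrable: "integrable N V" and V_mean: "(\<integral>y. V y \<partial>N) = sqrt (2 * real n / pi)"
proof -
  have "integrable N (\<lambda>y. \<bar>Z y\<bar>)"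
    using distributed_integrable[OF Z_distributed, of "\<lambda>x. \<bar>x\<bar>"] integrable_std_normal_moment_abs[of 1]
    by (simp add: normal_density_nonneg)
  then show "integrable N V" unfolding V_def[abs_def] by simp
  have "(\<integral>y. \<bar>Z y\<bar> \<partial>N) = sqrt (2 / pi)"
    using distributed_integral[OF Z_distributed, of "\<lambda>x. \<bar>x\<bar>"] integral_std_normal_moment_abs_odd[of 0]
    by (simp add: normal_density_nonneg)
  then show "(\<integral>y. V y \<partial>N) = sqrt (2 * real n / pi)"
    unfolding V_def[abs_def] by (simp add: real_sqrt_mult[symmetric] field_simps)
qed

end

section \<open>Comparison of the returns with the rounded half-normal variable\<close>

lemma ret_prob_eq_0: "m > 0 \<Longrightarrow> r > m \<Longrightarrow> ret_prob m r = 0"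
  by (simp add: ret_prob_def binomial_eq_0)

lemma cell_nonneg: "n > 0 \<Longrightarrow> r \<ge> 1 \<Longrightarrow> cell n r \<ge> 0"
  using cell_ge[of r n] half_normal_density_pos[of n "real r"] by linarith

text \<open>
  Once the mass of the rounded half-normal variable is at least that of the returns, it remains so,
  since its ratios of consecutive masses are larger. This happens at \<open>m + 1\<close> at the latest,
  where the return probability vanishes.
\<close>

lemma ret_prob_cell_crossing:
  assumes "m > 0"
  obtains r0 where "1 \<le> r0" "r0 \<le> 2 * m"
    "\<And>r. r0 \<le> r \<Longrightarrow> ret_prob m r \<le> cell (2 * m) r"
    "\<And>r. 1 \<le> r \<Longrightarrow> r < r0 \<Longrightarrow> cell (2 * m) r \<le> ret_prob m r"
proof -
  let ?P = "\<lambda>r. 1 \<le> r \<and> ret_prob m r \<le> cell (2 * m) r"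
  have step: "?P (Suc r)" if "?P r" for r
  proof (cases "r \<le> 2 * m")
    case True
    have "ret_prob m (Suc r) \<le> exp (- real r / real (2 * m)) * ret_prob m r"
      using ret_prob_Suc_le[OF assms True] by simp
    also have "\<dots> \<le> exp (- real r / real (2 * m)) * cell (2 * m) r"
      using that by (intro mult_left_mono) auto
    also have "\<dots> \<le> cell (2 * m) (Suc r)"
      using that assms by (intro cell_Suc_ge) auto
    finally show ?thesis by simp
  next
    case False
    then show ?thesis using assms by (simp add: ret_prob_eq_0 cell_nonneg)
  qed
  have ex: "?P (Suc m)" using assms by (simp add: ret_prob_eq_0 cell_nonneg)
  define r0 where "r0 = (LEAST r. ?P r)"
  have r0: "?P r0" unfolding r0_def using ex by (rule LeastI)
  have "r0 \<le> Suc m" unfolding r0_def using ex by (rule Least_le)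
  then have "r0 \<le> 2 * m" using assms by simp
  moreover have "?P r" if "r0 \<le> r" for r
    using that by (induction r rule: dec_induct) (use r0 step in blast)+
  moreover have "cell (2 * m) r \<le> ret_prob m r" if "1 \<le> r" "r < r0" for r
    using not_less_Least[of r ?P] that unfolding r0_def by auto
  ultimately show ?thesis using that r0 by blast
qed

lemma ret_prob_Suc_le_half_normal_density:
  assumes "m > 0"
  shows "ret_prob m (Suc r) \<le> half_normal_density (2 * m) (real r)"
proof (induction r)
  case 0
  have "ret_prob m (Suc 0) \<le> ret_prob m 0" using ret_prob_Suc_le[OF assms, of 0] by simp
  also have "\<dots> \<le> half_normal_density (2 * m) 0" using ret_prob_0_le[OF assms] by (simp add: half_normal_density_def)
  finally show ?case by simp
next
  case (Suc r)
  show ?case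
  proof (cases "Suc r \<le> 2 * m")
    case True
    have "- (real r + 1) / (2 * real m) + - (real r)\<^sup>2 / (2 * (2 * real m)) \<le> - (real r + 1)\<^sup>2 / (2 * (2 * real m))"
      using assms by (simp add: field_simps power2_eq_square)
    then have e: "exp (- (real r + 1) / (2 * real m)) * exp (- (real r)\<^sup>2 / (2 * (2 * real m)))
        \<le> exp (- (real r + 1)\<^sup>2 / (2 * (2 * real m)))"
      unfolding exp_add[symmetric] by simp
    have "ret_prob m (Suc (Suc r)) \<le> exp (- (real r + 1) / (2 * real m)) * ret_prob m (Suc r)"
      using ret_prob_Suc_le[OF assms True] by (simp add: add.commute)
    also have "\<dots> \<le> exp (- (real r + 1) / (2 * real m)) * half_normal_density (2 * m) (real r)"
      by (intro mult_left_mono Suc.IH) auto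
    also have "\<dots> \<le> half_normal_density (2 * m) (real (Suc r))"
      using mult_left_mono[OF e, of "sqrt (2 / (pi * real (2 * m)))"]
      unfolding half_normal_density_def by (simp add: mult_ac add.commute)
    finally show ?thesis .
  next
    case False
    then show ?thesis using assms half_normal_density_pos[of "2 * m" "real (Suc r)"] by (simp add: ret_prob_eq_0)
  qed
qed

text \<open>
  The masses at 0 and 1 are at most the density at 0 each; each later mass, at \<open>r + 1\<close>, is at most
  the density at \<open>r\<close>, hence at most the integral of the decreasing density over \<open>(r - 1, r]\<close>.
\<close>

lemma sum_ret_prob_le:
  assumes "m > 0"
  shows "(\<Sum>r\<le>Suc R. ret_prob m r) \<le> 2 * half_normal_density (2 * m) 0 + (\<Sum>r=1..R. cell (2 * m) r)"
proof (induction R)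
  case 0
  have "ret_prob m 0 \<le> half_normal_density (2 * m) 0" using ret_prob_0_le[OF assms] by (simp add: half_normal_density_def)
  then show ?case using ret_prob_Suc_le_half_normal_density[OF assms, of 0] by simp
next
  case (Suc R)
  have "ret_prob m (Suc (Suc R)) \<le> cell (2 * m) (Suc R)"
    using ret_prob_Suc_le_half_normal_density[OF assms, of "Suc R"] cell_ge[of "Suc R" "2 * m"] by simp
  with Suc.IH show ?case by simp
qed

context half_normal
begin

text \<open>
  With the crossing point \<open>r0\<close>, the differences of the two masses and \<open>g r - g r0\<close> always have the
  same sign, so \<open>g - g r0\<close> has the larger mean under \<open>C\<close>; adding the constant \<open>g r0\<close> shifts both
  means equally. For \<open>C > n\<close> the integrand is nonnegative and may be dropped, which
  leaves finite sums. The atom of the returns at 0, where \<open>C\<close> has no mass, lies left of \<open>r0\<close>.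
\<close>

lemma returns_dominated:
  fixes g :: "nat \<Rightarrow> real"
  assumes n: "n = 2 * m" and mono: "\<And>r s. r \<le> s \<Longrightarrow> g r \<le> g s" and int: "integrable N (\<lambda>y. g (C y))"
  shows "(\<Sum>r\<le>n. ret_prob m r * g r) \<le> (\<integral>y. g (C y) \<partial>N)"
proof -
  have m: "m > 0" using n n_pos by simp
  obtain r0 where r0: "1 \<le> r0" "r0 \<le> n"
    "\<And>r. r0 \<le> r \<Longrightarrow> ret_prob m r \<le> cell n r"
    "\<And>r. 1 \<le> r \<Longrightarrow> r < r0 \<Longrightarrow> cell n r \<le> ret_prob m r"
    using ret_prob_cell_crossing[OF m] unfolding n by blast
  define G where "G r = g r - g r0" for r
  have G: "G r * ret_prob m r \<le> G r * cell n r" if "1 \<le> r" for r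
  proof (cases "r0 \<le> r")
    case True
    then show ?thesis using r0(3) mono[of r0 r] by (intro mult_left_mono) (auto simp: G_def)
  next
    case False
    then show ?thesis using r0(4)[OF that] mono[of r r0]
      by (intro mult_left_mono_neg) (auto simp: G_def)
  qed
  have Gint: "integrable N (\<lambda>y. G (C y))" unfolding G_def using int by simp
  have "(\<Sum>r\<le>n. ret_prob m r * g r) = (\<Sum>r\<le>n. G r * ret_prob m r + g r0 * ret_prob m r)"
    by (intro sum.cong) (auto simp: G_def algebra_simps)
  also have "\<dots> = (\<Sum>r\<le>n. G r * ret_prob m r) + g r0"
    using sum_ret_prob[OF m] by (simp add: sum.distrib sum_distrib_left[symmetric] n)
  finally have g_eq: "(\<Sum>r\<le>n. ret_prob m r * g r) = (\<Sum>r\<le>n. G r * ret_prob m r) + g r0" .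
  have "(\<Sum>r\<le>n. G r * ret_prob m r) = G 0 * ret_prob m 0 + (\<Sum>r=1..n. G r * ret_prob m r)"
    by (simp add: sum.atLeast_Suc_atMost atMost_atLeast0)
  moreover have "G 0 * ret_prob m 0 \<le> 0"
    using mono[of 0 r0] ret_prob_nonneg by (intro mult_nonpos_nonneg) (auto simp: G_def)
  ultimately have "(\<Sum>r\<le>n. G r * ret_prob m r) \<le> (\<Sum>r=1..n. G r * ret_prob m r)" by simp
  also have "\<dots> \<le> (\<Sum>r=1..n. G r * cell n r)"
    by (intro sum_mono G) auto
  also have "(\<Sum>r=1..n. G r * cell n r) = (\<integral>y. G (C y) * indicator {..real n} (V y) \<partial>N)"
    unfolding cell_def by (subst expectation_C_upto) auto
  also have "\<dots> \<le> (\<integral>y. G (C y) \<partial>N)"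
  proof (rule integral_mono_AE)
    show "integrable N (\<lambda>y. G (C y) * indicator {..real n} (V y))"
      by (rule Bochner_Integration.integrable_bound[OF Gint]) (auto simp: indicator_def)
    show "AE y in N. G (C y) * indicator {..real n} (V y) \<le> G (C y)"
      using AE_V_pos
    proof eventually_elim
      case (elim y)
      show ?case
      proof (cases "V y \<le> real n")
        case False
        then have "real n < real (C y)" using overshoot_bounds(1)[OF elim] by simp
        then have "r0 \<le> C y" using r0(2) by simp
        then show ?thesis using mono[of r0 "C y"] by (simp add: G_def indicator_def)
      qed simp
    qed
  qed (rule Gint)
  also have "(\<integral>y. G (C y) \<partial>N) = (\<integral>y. g (C y) \<partial>N) - g r0"
    unfolding G_def using int by (simp add: prob_space)
  finally show ?thesis unfolding g_eq by simp
qed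

text \<open>
  Domination is applied to \<open>r + H r\<close> and to \<open>r - H r\<close>, which are nondecreasing as \<open>H\<close> is 1-Lipschitz;
  this bounds the difference of the means of \<open>H\<close> under the two laws by the difference of the means
  of \<open>C\<close> and of the number of returns. The step from \<open>C\<close> to \<open>V\<close> costs the mean overshoot, which thus enters twice.
\<close>

lemma returns_lipschitz_bound:
  assumes n: "n = 2 * m" and H: "1-lipschitz_on UNIV H"
  shows "\<bar>(\<Sum>r\<le>n. ret_prob m r * H (real r)) - (\<integral>y. H (V y) \<partial>N)\<bar> \<le> 2 + half_normal_density n 0"
proof -
  have m: "m > 0" using n n_pos by simp
  have lip: "\<bar>H x - H y\<bar> \<le> \<bar>x - y\<bar>" for x y
    using lipschitz_onD[OF H, of x y] by (simp add: dist_real_def)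
  have "continuous_on UNIV H" using H by (rule lipschitz_on_continuous_on)
  then have [measurable]: "H \<in> borel_measurable borel" by (rule borel_measurable_continuous_onI)
  have Hint: "integrable N (\<lambda>y. H (U y))" if U: "integrable N U" for U
  proof (rule Bochner_Integration.integrable_bound)
    show "integrable N (\<lambda>y. \<bar>H 0\<bar> + \<bar>U y\<bar>)" using U by auto
    show "(\<lambda>y. H (U y)) \<in> borel_measurable N" using U by measurable
    show "AE y in N. norm (H (U y)) \<le> norm (\<bar>H 0\<bar> + \<bar>U y\<bar>)"
    proof (rule AE_I2)
      fix y show "norm (H (U y)) \<le> norm (\<bar>H 0\<bar> + \<bar>U y\<bar>)" using lip[of "U y" 0] by simp
    qed
  qed
  have Cint: "integrable N (\<lambda>y. real (C y))"
    using Bochner_Integration.integrable_add[OF overshoot_integrable V_integrable] by simp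
  note HC = Hint[OF Cint] and HV = Hint[OF V_integrable]
  have "(\<Sum>r\<le>n. ret_prob m r * (real r + H (real r))) \<le> (\<integral>y. real (C y) + H (real (C y)) \<partial>N)"
  proof (rule returns_dominated[OF n])
    show "real r + H (real r) \<le> real s + H (real s)" if "r \<le> s" for r s
      using lip[of "real r" "real s"] that by simp
  qed (use Cint HC in auto)
  then have 1: "(\<Sum>r\<le>n. ret_prob m r * real r) + (\<Sum>r\<le>n. ret_prob m r * H (real r)) \<le>
      (\<integral>y. real (C y) \<partial>N) + (\<integral>y. H (real (C y)) \<partial>N)"
    using Cint HC by (simp add: distrib_left sum.distrib)
  have "(\<Sum>r\<le>n. ret_prob m r * (real r - H (real r))) \<le> (\<integral>y. real (C y) - H (real (C y)) \<partial>N)"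
  proof (rule returns_dominated[OF n])
    show "real r - H (real r) \<le> real s - H (real s)" if "r \<le> s" for r s
      using lip[of "real r" "real s"] that by simp
  qed (use Cint HC in auto)
  then have 2: "(\<Sum>r\<le>n. ret_prob m r * real r) - (\<Sum>r\<le>n. ret_prob m r * H (real r)) \<le>
      (\<integral>y. real (C y) \<partial>N) - (\<integral>y. H (real (C y)) \<partial>N)"
    using Cint HC by (simp add: right_diff_distrib sum_subtractf)
  have "\<bar>(\<integral>y. H (real (C y)) \<partial>N) - (\<integral>y. H (V y) \<partial>N)\<bar> = \<bar>\<integral>y. H (real (C y)) - H (V y) \<partial>N\<bar>"
    using HC HV by simp
  also have "\<dots> \<le> (\<integral>y. \<bar>H (real (C y)) - H (V y)\<bar> \<partial>N)" by (rule integral_abs_bound)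
  also have "\<dots> \<le> (\<integral>y. real (C y) - V y \<partial>N)"
  proof (rule integral_mono_AE)
    show "AE y in N. \<bar>H (real (C y)) - H (V y)\<bar> \<le> real (C y) - V y"
      using AE_V_pos
    proof eventually_elim
      case (elim y)
      show ?case using lip[of "real (C y)" "V y"] overshoot_bounds(1)[OF elim] by simp
    qed
  qed (use HC HV overshoot_integrable in auto)
  finally have 3: "\<bar>(\<integral>y. H (real (C y)) \<partial>N) - (\<integral>y. H (V y) \<partial>N)\<bar> \<le> (\<integral>y. real (C y) - V y \<partial>N)" .
  have 4: "(\<integral>y. real (C y) \<partial>N) = (\<integral>y. real (C y) - V y \<partial>N) + (\<integral>y. V y \<partial>N)"
    using Cint V_integrable by simp
  have 5: "(\<integral>y. V y \<partial>N) - 1 \<le> (\<Sum>r\<le>n. ret_prob m r * real r)"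
    unfolding V_mean using mean_ret_prob_ge[OF m] n by simp
  show ?thesis using 1 2 3 4 5 mean_overshoot unfolding abs_le_iff by argo
qed

text \<open>
  The distribution function of the returns is constant between integers, and there it is at
  least that of \<open>V\<close>, by domination applied to the indicator of \<open>{..R}\<close> with negative sign.
\<close>

lemma returns_cdf_bound:
  assumes n: "n = 2 * m"
  shows "\<bar>(\<Sum>r\<le>n. ret_prob m r * of_bool (real r \<le> z)) - prob {y \<in> space N. V y \<le> z}\<bar> \<le> 2 * half_normal_density n 0"
proof (cases "z < 0")
  case True
  then show ?thesis using half_normal_density_pos[OF n_pos, of 0] by (simp add: prob_V_le)
next
  case False
  have m: "m > 0" using n n_pos by simp
  define R where "R = nat \<lfloor>z\<rfloor>"
  have "real_of_int \<lfloor>z\<rfloor> = real R" using False by (simp add: R_def)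
  then have R: "real R \<le> z" "z \<le> real R + 1" by linarith+
  have iff: "real r \<le> z \<longleftrightarrow> r \<le> R" for r
    using False by (simp add: R_def le_nat_iff le_floor_iff)
  let ?F = "\<Sum>r\<le>n. ret_prob m r * of_bool (real r \<le> z)"
  have "integral {0..z} (half_normal_density n) = integral {0..real R} (half_normal_density n) + integral {real R..z} (half_normal_density n)"
    using R(1) by (intro Henstock_Kurzweil_Integration.integral_combine[symmetric] half_normal_density_integrable_on) auto
  also have "integral {real R..z} (half_normal_density n) \<le> integral {real R..z} (\<lambda>_. half_normal_density n 0)"
    by (intro integral_le half_normal_density_integrable_on half_normal_density_antimono) auto
  also have "\<dots> \<le> half_normal_density n 0"
    using R half_normal_density_pos[OF n_pos, of 0] by (simp add: mult_left_le_one_le)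
  finally have up: "prob {y \<in> space N. V y \<le> z} \<le> prob {y \<in> space N. V y \<le> real R} + half_normal_density n 0"
    unfolding prob_V_le by simp
  have "(\<Sum>r\<le>n. ret_prob m r * - of_bool (r \<le> R)) \<le> (\<integral>y. - of_bool (C y \<le> R) \<partial>N)"
    by (rule returns_dominated[OF n]) (auto intro!: integrable_const_bound[where B = 1])
  also have "(\<integral>y. - of_bool (C y \<le> R) \<partial>N) = (\<integral>y. - indicator {y \<in> space N. V y \<le> real R} y \<partial>N)"
    by (intro Bochner_Integration.integral_cong refl)
       (auto simp: C_def nat_le_iff ceiling_le_iff indicator_def)
  finally have dom: "prob {y \<in> space N. V y \<le> real R} \<le> ?F"
    by (simp add: iff sum_negf)
  have "?F = (\<Sum>r\<le>n. if r \<in> {..R} then ret_prob m r else 0)"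
    by (intro sum.cong) (auto simp: iff)
  also have "\<dots> = (\<Sum>r\<in>{..n} \<inter> {..R}. ret_prob m r)"
    by (rule sum.inter_restrict[symmetric]) simp
  also have "\<dots> \<le> (\<Sum>r\<le>Suc R. ret_prob m r)"
    by (intro sum_mono2) (auto simp: ret_prob_nonneg)
  also have "\<dots> \<le> 2 * half_normal_density n 0 + prob {y \<in> space N. V y \<le> real R}"
    using sum_ret_prob_le[OF m, of R] sum_cell[of R] unfolding n by simp
  also have "prob {y \<in> space N. V y \<le> real R} \<le> prob {y \<in> space N. V y \<le> z}"
    using R by (intro finite_measure_mono) auto
  finally show ?thesis using up dom half_normal_density_pos[OF n_pos, of 0] by linarith
qed

end

section \<open>The distance bounds\<close>

theorem theorem1p1:
  fixes M :: "'a measure" and N :: "'b measure"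
    and X :: "nat \<Rightarrow> 'a \<Rightarrow> real" and Z :: "'b \<Rightarrow> real"
    and W :: "'a \<Rightarrow> real" and Y :: "'b \<Rightarrow> real"
    and n m :: nat
  assumes "prob_space M" and "prob_space N"
    and "simple_symmetric_steps M X"
    and "distributed N lborel Z std_normal_density"
    and "n = 2 * m" and "n > 0"
    and W: "W = (\<lambda>\<omega>. real (returns X n \<omega>) / sqrt (real n))"
    and Y: "Y = (\<lambda>\<omega>. \<bar>Z \<omega>\<bar>)"
  shows "wasserstein_dist M W N Y
           \<le> ereal (1 / sqrt (real n) * (2 / pi + 2) + 1 / real n * sqrt (2 / pi))
       \<and> kolmogorov_dist M W N Y
           \<le> 1 / sqrt (real n) * ((3 + 2 * sqrt 2) / sqrt (2 * pi) + 3 / 4) + 3 / (2 * real n)"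
proof -
  interpret M: simple_random_walk M X
    using assms by (simp add: simple_random_walk_def simple_random_walk_axioms_def)
  interpret N: half_normal N Z n
    using assms by (simp add: half_normal_def half_normal_axioms_def)
  define s where "s = sqrt (real n)"
  have s: "s > 0" "s * s = real n" using \<open>n > 0\<close> by (simp_all add: s_def)
  have m: "m > 0" using assms by simp
  have density_0: "half_normal_density n 0 = sqrt (2 / pi) / s"
    by (simp add: half_normal_density_def s_def real_sqrt_divide real_sqrt_mult)
  have V: "N.V y = s * Y y" for y by (simp add: N.V_def Y s_def)
  have law: "(\<integral>\<omega>. F (returns X n \<omega>) \<partial>M) = (\<Sum>r\<le>n. ret_prob m r * F r)" for F :: "nat \<Rightarrow> real"
    using M.expectation_returns[OF m, of F] assms(5) by simp
  have "wasserstein_dist M W N Y \<le> ereal ((2 + half_normal_density n 0) / s)"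
    unfolding wasserstein_dist_def
  proof (rule SUP_least, clarify)
    fix h :: "real \<Rightarrow> real" assume h: "1-lipschitz_on UNIV h"
    define H where "H x = s * h (x / s)" for x
    have "1-lipschitz_on UNIV H"
    proof (rule lipschitz_onI)
      fix x y
      have "dist (H x) (H y) = s * dist (h (x / s)) (h (y / s))"
        using s by (simp add: H_def dist_real_def right_diff_distrib[symmetric] abs_mult)
      also have "\<dots> \<le> s * dist (x / s) (y / s)"
        using s lipschitz_onD[OF h, of "x / s" "y / s"] by (intro mult_left_mono) auto
      also have "\<dots> = 1 * dist x y"
        using s by (simp add: dist_real_def diff_divide_distrib[symmetric] abs_divide)
      finally show "dist (H x) (H y) \<le> 1 * dist x y" .
    qed simp
    from N.returns_lipschitz_bound[OF assms(5) this]
    have "\<bar>(\<Sum>r\<le>n. ret_prob m r * H (real r)) - (\<integral>y. H (N.V y) \<partial>N)\<bar> / s \<le> (2 + half_normal_density n 0) / s"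
      using s by (intro divide_right_mono) auto
    also have "(\<Sum>r\<le>n. ret_prob m r * H (real r)) = s * (\<integral>\<omega>. h (W \<omega>) \<partial>M)"
      unfolding W H_def s_def[symmetric] law[of "\<lambda>r. h (real r / s)"]
      by (simp add: sum_distrib_left mult_ac)
    also have "(\<integral>y. H (N.V y) \<partial>N) = s * (\<integral>y. h (Y y) \<partial>N)"
      unfolding H_def V using s by simp
    finally show "ereal \<bar>(\<integral>\<omega>. h (W \<omega>) \<partial>M) - (\<integral>y. h (Y y) \<partial>N)\<bar> \<le> ereal ((2 + half_normal_density n 0) / s)"
      using s by (simp add: right_diff_distrib[symmetric] abs_mult)
  qed
  also have "(2 + half_normal_density n 0) / s = 1 / s * 2 + 1 / real n * sqrt (2 / pi)"
    unfolding density_0 s(2)[symmetric] using s(1) by (simp add: field_simps)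
  also have "\<dots> \<le> 1 / s * (2 / pi + 2) + 1 / real n * sqrt (2 / pi)"
    using s by (intro add_right_mono mult_left_mono) auto
  finally have wasserstein: "wasserstein_dist M W N Y
      \<le> ereal (1 / s * (2 / pi + 2) + 1 / real n * sqrt (2 / pi))" by simp
  have "kolmogorov_dist M W N Y \<le> 2 * half_normal_density n 0"
    unfolding kolmogorov_dist_def
  proof (rule cSUP_least)
    fix z :: real
    have "{\<omega> \<in> space M. W \<omega> \<le> z} \<inter> space M = {\<omega> \<in> space M. W \<omega> \<le> z}" by auto
    then have "measure M {\<omega> \<in> space M. W \<omega> \<le> z} = (\<integral>\<omega>. indicator {\<omega> \<in> space M. W \<omega> \<le> z} \<omega> \<partial>M)"
      by simp
    also have "\<dots> = (\<integral>\<omega>. of_bool (real (returns X n \<omega>) \<le> s * z) \<partial>M)"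
      using s by (intro Bochner_Integration.integral_cong refl)
        (simp add: W s_def[symmetric] indicator_def pos_divide_le_eq mult.commute)
    also have "\<dots> = (\<Sum>r\<le>n. ret_prob m r * of_bool (real r \<le> s * z))" by (rule law)
    finally have 1: "measure M {\<omega> \<in> space M. W \<omega> \<le> z} = \<dots>" .
    have "{y \<in> space N. Y y \<le> z} = {y \<in> space N. N.V y \<le> s * z}"
      using s by (auto simp: V)
    then show "\<bar>measure M {\<omega> \<in> space M. W \<omega> \<le> z} - measure N {y \<in> space N. Y y \<le> z}\<bar> \<le> 2 * half_normal_density n 0"
      unfolding 1 using N.returns_cdf_bound[OF assms(5), of "s * z"] by simp
  qed simp
  also have "2 * half_normal_density n 0 = 1 / s * (4 / sqrt (2 * pi))"
  proof -
    have "2 * sqrt (2 / pi) = sqrt (4 * (2 / pi))" by (simp only: real_sqrt_mult real_sqrt_four)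
    also have "\<dots> = sqrt (16 / (2 * pi))" by simp
    also have "\<dots> = 4 / sqrt (2 * pi)"
      using real_sqrt_unique[of 4 16] by (simp only: real_sqrt_divide) simp
    finally show ?thesis unfolding density_0 by simp
  qed
  also have "\<dots> \<le> 1 / s * ((3 + 2 * sqrt 2) / sqrt (2 * pi) + 3 / 4)"
  proof (intro mult_left_mono)
    have "4 / sqrt (2 * pi) \<le> (3 + 2 * sqrt 2) / sqrt (2 * pi)"
    proof (rule divide_right_mono)
      have "1 \<le> sqrt (2 :: real)" by simp
      then show "4 \<le> 3 + 2 * sqrt (2 :: real)" by linarith
    qed simp
    then show "4 / sqrt (2 * pi) \<le> (3 + 2 * sqrt 2) / sqrt (2 * pi) + 3 / 4" by simp
  qed (use s in simp)
  also have "\<dots> \<le> 1 / s * ((3 + 2 * sqrt 2) / sqrt (2 * pi) + 3 / 4) + 3 / (2 * real n)" by simp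
  finally show ?thesis using wasserstein unfolding s_def by simp
qed

end
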